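(* Fix two distinct primes $p$ and $q$. Then, with at most finitely many exceptions, no cyclic group $\mathbb{Z}_N$ with $\operatorname{rad}(N)=pq$ possesses a pair of primitive formally dual subsets. That is, the set of positive integers $N$ with $\operatorname{rad}(N)=pq$ for which there exist subsets $S,T\subseteq\mathbb{Z}_N$, both primitive and formally dual to each other, is finite.
   Context: $\mathbb{Z}_N$ is the cyclic group (ring of integers) modulo $N$, $\zeta_N=e^{2\pi i/N}$, and $\operatorname{rad}(N)$ is the product of the distinct primes dividing $N$. A subset $T\subseteq\mathbb{Z}_N$ is primitive if it is not contained in any coset of a proper subgroup of $\mathbb{Z}_N$. For $T\subseteq\mathbb{Z}_N$ let $\nu_T(y)=\#\{(t,t')\in T\times T: t-t'=y\}$. Two nonempty subsets $S,T\subseteq\mathbb{Z}_N$ are formally dual if for every $y\in\mathbb{Z}_N$, $\frac{1}{|S|^2}\left|\sum_{x\in S}\zeta_N^{xy}\right|^2=\frac{1}{|T|}\nu_T(y)$. *)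

theory Defs
  imports Complex_Main "HOL-Computational_Algebra.Primes" "HOL-Algebra.Elementary_Groups"
begin

text \<open>
  The group Z_N is the library's \<open>integer_mod_group N\<close>, whose carrier for \<open>N > 0\<close> is the set
  \<open>{0..<int N}\<close> of least nonnegative residues.
\<close>

definition rad :: "nat \<Rightarrow> nat" where
  "rad N = \<Prod>(prime_factors N)"

definition primitive_subset :: "nat \<Rightarrow> int set \<Rightarrow> bool" where
  "primitive_subset N T \<longleftrightarrow>
     T \<subseteq> carrier (integer_mod_group N) \<and>
     \<not> (\<exists>H a. subgroup H (integer_mod_group N) \<and> H \<noteq> carrier (integer_mod_group N) \<and>
             a \<in> carrier (integer_mod_group N) \<and> T \<subseteq> H #>\<^bsub>integer_mod_group N\<^esub> a)"

definition zeta :: "nat \<Rightarrow> complex" where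
  "zeta N = exp (2 * of_real pi * \<i> / of_nat N)"

definition nu :: "nat \<Rightarrow> int set \<Rightarrow> int \<Rightarrow> nat" where
  "nu N T y = card {(t, t'). t \<in> T \<and> t' \<in> T \<and> (t - t') mod int N = y}"

text \<open>
  The value of \<open>zeta N powi (x * y)\<close> depends only on the residues of \<open>x\<close> and \<open>y\<close> modulo \<open>N\<close>,
  so the product of representatives need not be reduced.
\<close>

definition formally_dual :: "nat \<Rightarrow> int set \<Rightarrow> int set \<Rightarrow> bool" where
  "formally_dual N S T \<longleftrightarrow>
     S \<subseteq> carrier (integer_mod_group N) \<and> S \<noteq> {} \<and>
     T \<subseteq> carrier (integer_mod_group N) \<and> T \<noteq> {} \<and>
     (\<forall>y \<in> carrier (integer_mod_group N).
        1 / real (card S) ^ 2 * (cmod (\<Sum>x\<in>S. zeta N powi (x * y))) ^ 2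
          = 1 / real (card T) * real (nu N T y))"

end

theory Submission
  imports Defs "HOL-Library.Function_Algebras" "HOL-Number_Theory.Number_Theory"
begin

text \<open>
  If \<open>S\<close> and \<open>T\<close> are formally dual then \<open>|S| |T| = N\<close>, the relation is symmetric, and for units \<open>u\<close> the
  number \<open>n = |\<Sum>x\<in>S. \<zeta>^(x u)|^2\<close> is an integer independent of \<open>u\<close>, related to the common value
  \<open>\<nu>\<close> of \<open>\<nu>_T\<close> at the units by \<open>n |T| = |S|^2 \<nu>\<close>. Primitivity makes \<open>\<nu>\<close> and its analogue for \<open>S\<close>
  positive (this uses that only two primes divide \<open>N\<close>). Counting differences then bounds \<open>\<nu>\<close> by
  \<open>(p q)^2\<close> and shows \<open>n^2 \<ge> N / (p q)^3\<close>, while all primes dividing \<open>n\<close> are at most \<open>(p q)^2\<close>.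

  On the other hand \<open>n\<close> is bounded by field descent. There is an \<open>F\<close> depending only on \<open>p\<close>, \<open>q\<close> such that
  \<open>\<sigma>: \<zeta> \<mapsto> \<zeta>^(1 + F)\<close> fixes all prime ideals above the primes dividing \<open>n\<close>. Hence
  \<open>\<sigma> X = U X\<close> for \<open>X = \<Sum>x\<in>S. \<zeta>^x\<close> and a \<open>U\<close> all of whose conjugates have modulus \<open>1\<close>, so
  \<open>U\<close> is a \<open>2N\<close>-th root of unity. Averaging \<open>X\<close> over the powers of \<open>\<sigma>\<close>, corrected by the
  corresponding roots of unity, kills all but at most \<open>F\<close> terms of the sum, so \<open>n = |X|^2 \<le> F^2\<close>.

  Prime ideals and the irreducibility of cyclotomic polynomials are avoided: \<open>\<int>[\<zeta>]\<close> is replaced by the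
  ring of functions \<open>u \<mapsto> g(\<zeta>^u)\<close> on the units modulo \<open>N\<close>, \<open>g \<in> \<int>[x]\<close>, on which the Galois action is
  visibly well defined.
\<close>

section \<open>Subrings generated by one element\<close>

inductive_set subring_gen :: "'a::comm_ring_1 \<Rightarrow> 'a set" for c :: 'a where
  one: "1 \<in> subring_gen c"
| gen: "c \<in> subring_gen c"
| diff: "x \<in> subring_gen c \<Longrightarrow> y \<in> subring_gen c \<Longrightarrow> x - y \<in> subring_gen c"
| mult: "x \<in> subring_gen c \<Longrightarrow> y \<in> subring_gen c \<Longrightarrow> x * y \<in> subring_gen c"

lemma subring_gen_zero: "0 \<in> subring_gen c"
  using subring_gen.diff[OF subring_gen.one subring_gen.one] by simp

lemma subring_gen_uminus: "x \<in> subring_gen c \<Longrightarrow> - x \<in> subring_gen c"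
  using subring_gen.diff[OF subring_gen_zero] by fastforce

lemma subring_gen_add: "x \<in> subring_gen c \<Longrightarrow> y \<in> subring_gen c \<Longrightarrow> x + y \<in> subring_gen c"
  using subring_gen.diff[OF _ subring_gen_uminus] by fastforce

lemma subring_gen_power: "x \<in> subring_gen c \<Longrightarrow> x ^ n \<in> subring_gen c"
  by (induction n) (auto intro: subring_gen.intros)

lemma subring_gen_of_nat: "of_nat n \<in> subring_gen c"
  by (induction n) (auto intro: subring_gen_zero subring_gen.one subring_gen_add)

lemma subring_gen_sum: "(\<And>i. i \<in> A \<Longrightarrow> f i \<in> subring_gen c) \<Longrightarrow> sum f A \<in> subring_gen c"
  by (induction A rule: infinite_finite_induct) (auto intro: subring_gen_zero subring_gen_add)

lemmas subring_gen_intros = subring_gen.intros subring_gen_zero subring_gen_uminus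
  subring_gen_add subring_gen_power subring_gen_of_nat subring_gen_sum

text \<open>Additively \<open>subring_gen c\<close> is generated by the powers of \<open>c\<close>.
  This extends integrality of traces and of rational functionals from powers of a root of unity to
  the whole ring.\<close>

lemma subring_gen_additive:
  fixes c :: "'a::comm_ring_1" and L :: "'a \<Rightarrow> 'b::ab_group_add" and G :: "'b set"
  assumes G: "\<And>a b. a \<in> G \<Longrightarrow> b \<in> G \<Longrightarrow> a - b \<in> G"
    and x: "x \<in> subring_gen c"
    and L: "\<And>a b. L (a - b) = L a - L b"
    and gen: "\<And>j. L (c ^ j) \<in> G"
  shows "L x \<in> G"
proof -
  \<comment> \<open>Keeping \<open>L\<close> arbitrary lets the product case apply the hypothesis
    for \<open>y\<close> to the additive map \<open>\<lambda>z. L (x * z)\<close>.\<close>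
  have "L (x * c ^ j) \<in> G" if "\<And>a b. L (a - b) = L a - L b" "\<And>j. L (c ^ j) \<in> G"
    for L :: "'a \<Rightarrow> 'b" and j
    using x that
  proof (induction arbitrary: L j)
    case one
    then show ?case by simp
  next
    case gen
    then show ?case by (metis power_Suc)
  next
    case (diff x y)
    then show ?case using G by (simp add: left_diff_distrib)
  next
    case (mult x y)
    have "L (x * c ^ j) \<in> G" for j using mult.IH(1) mult.prems by blast
    then show ?case
      using mult.IH(2)[of "\<lambda>z. L (x * z)" j] mult.prems
      by (simp add: right_diff_distrib mult.assoc)
  qed
  from this[of L 0] L gen show ?thesis by simp
qed

section \<open>Congruences modulo principal ideals, and the Frobenius map\<close>

text \<open>The cofactor is confined to the subring because in a ring of complex-valued functions
  every nowhere vanishing \<open>d\<close> is a unit, so divisibility in the ambient ring would say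
  nothing.\<close>

definition gcong :: "'a::comm_ring_1 \<Rightarrow> 'a \<Rightarrow> 'a \<Rightarrow> 'a \<Rightarrow> bool" where
  "gcong c d x y \<longleftrightarrow> (\<exists>w \<in> subring_gen c. x - y = d * w)"

lemma gcong_refl: "gcong c d x x"
  unfolding gcong_def by (rule bexI[of _ 0]) (auto intro: subring_gen_zero)

lemma gcong_sym: "gcong c d x y \<Longrightarrow> gcong c d y x"
  unfolding gcong_def by (metis minus_diff_eq mult_minus_right subring_gen_uminus)

lemma gcong_add: "gcong c d x y \<Longrightarrow> gcong c d x' y' \<Longrightarrow> gcong c d (x + x') (y + y')"
  unfolding gcong_def by (metis add_diff_add distrib_left subring_gen_add)

lemma gcong_trans: "gcong c d x y \<Longrightarrow> gcong c d y z \<Longrightarrow> gcong c d x z"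
  using gcong_add[of c d x y y z] unfolding gcong_def by simp

lemma gcong_diff: "gcong c d x y \<Longrightarrow> gcong c d x' y' \<Longrightarrow> gcong c d (x - x') (y - y')"
  using gcong_add[of c d x y y' x'] gcong_sym[of c d x' y'] unfolding gcong_def by (simp add: algebra_simps)

lemma gcong_mult:
  assumes "gcong c d x y" "gcong c d x' y'" "x \<in> subring_gen c" "y' \<in> subring_gen c"
  shows "gcong c d (x * x') (y * y')"
proof -
  obtain w w' where w: "w \<in> subring_gen c" "x - y = d * w" "w' \<in> subring_gen c" "x' - y' = d * w'"
    using assms unfolding gcong_def by blast
  have "x * x' - y * y' = x * (x' - y') + (x - y) * y'" by (simp add: algebra_simps)
  also have "\<dots> = d * (x * w' + w * y')" unfolding w by (simp add: algebra_simps)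
  finally show ?thesis unfolding gcong_def using w assms by (auto intro!: subring_gen_intros bexI)
qed

lemma gcong_power:
  assumes "gcong c d x y" "x \<in> subring_gen c" "y \<in> subring_gen c"
  shows "gcong c d (x ^ n) (y ^ n)"
  using assms by (induction n) (auto intro: gcong_refl gcong_mult subring_gen_power)

lemma gcong_dvd: "gcong c d x y \<Longrightarrow> d = e * w \<Longrightarrow> w \<in> subring_gen c \<Longrightarrow> gcong c e x y"
  unfolding gcong_def by (metis mult.assoc subring_gen.mult)

lemma gcong_freshman:
  assumes "prime r" "x \<in> subring_gen c" "y \<in> subring_gen c"
  shows "gcong c (of_nat r) ((x + y) ^ r) (x ^ r + y ^ r)"
proof -
  have r: "r \<ge> 1" using assms(1) prime_gt_0_nat by (simp add: Suc_leI)
  have "(x + y) ^ r = (\<Sum>k\<le>r. of_nat (r choose k) * x ^ k * y ^ (r - k))" by (rule binomial_ring)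
  also have "{..r} = insert 0 (insert r {1..<r})" using r by auto
  also have "(\<Sum>k\<in>\<dots>. of_nat (r choose k) * x ^ k * y ^ (r - k)) =
      x ^ r + y ^ r + (\<Sum>k\<in>{1..<r}. of_nat (r choose k) * x ^ k * y ^ (r - k))"
    using r by (simp add: algebra_simps)
  also have "(\<Sum>k\<in>{1..<r}. of_nat (r choose k) * x ^ k * y ^ (r - k)) =
      of_nat r * (\<Sum>k\<in>{1..<r}. of_nat ((r choose k) div r) * x ^ k * y ^ (r - k))"
    unfolding sum_distrib_left
  proof (rule sum.cong[OF refl])
    fix k assume k: "k \<in> {1..<r}"
    then have "r dvd (r choose k)" using dvd_choose_prime[OF _ _ _ assms(1), of k] by auto
    then have "r choose k = r * ((r choose k) div r)" by simp
    then have "(of_nat (r choose k) :: 'a) = of_nat r * of_nat ((r choose k) div r)"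
      by (metis of_nat_mult)
    then show "of_nat (r choose k) * x ^ k * y ^ (r - k) =
       of_nat r * (of_nat ((r choose k) div r) * x ^ k * y ^ (r - k))"
      by (simp add: mult.assoc)
  qed
  finally show ?thesis
    unfolding gcong_def using assms by (auto intro!: bexI subring_gen_intros)
qed

lemma gcong_freshman_diff:
  assumes "prime r" "x \<in> subring_gen c" "y \<in> subring_gen c"
  shows "gcong c (of_nat r) ((x - y) ^ r) (x ^ r - y ^ r)"
proof -
  have "gcong c (of_nat r) (x ^ r) ((x - y) ^ r + y ^ r)"
    using gcong_freshman[OF assms(1), of "x - y" c y] assms by (auto intro: subring_gen_intros)
  from gcong_diff[OF gcong_sym[OF this] gcong_refl[of _ _ "y ^ r"]] show ?thesis by simp
qed

lemma gcong_freshman_iterate: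
  assumes "prime r" "x \<in> subring_gen c" "y \<in> subring_gen c"
  shows "gcong c (of_nat r) ((x - y) ^ (r ^ j)) (x ^ (r ^ j) - y ^ (r ^ j))"
proof (induction j)
  case 0
  show ?case by (simp add: gcong_refl)
next
  case (Suc j)
  have "gcong c (of_nat r) (((x - y) ^ (r ^ j)) ^ r) ((x ^ (r ^ j) - y ^ (r ^ j)) ^ r)"
    using Suc assms by (intro gcong_power subring_gen_intros)
  moreover have "gcong c (of_nat r) ((x ^ (r ^ j) - y ^ (r ^ j)) ^ r)
      ((x ^ (r ^ j)) ^ r - (y ^ (r ^ j)) ^ r)"
    using assms by (intro gcong_freshman_diff subring_gen_intros)
  ultimately show ?case
    using gcong_trans by (fastforce simp: power_mult[symmetric] mult.commute)
qed

locale ring_hom_fun =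
  fixes \<sigma> :: "'a::comm_ring_1 \<Rightarrow> 'a"
  assumes hom_one: "\<sigma> 1 = 1"
    and hom_diff: "\<sigma> (x - y) = \<sigma> x - \<sigma> y"
    and hom_mult: "\<sigma> (x * y) = \<sigma> x * \<sigma> y"

text \<open>As \<open>d\<close> divides \<open>r\<close>, raising to the power \<open>r ^ j\<close>
  is a ring homomorphism modulo \<open>d\<close>, and two homomorphisms agreeing at the generator
  agree everywhere. Besides Galois automorphisms, \<open>\<sigma>\<close> will also be the identity,
  which makes powers periodic.\<close>

lemma (in ring_hom_fun) frobenius_gcong:
  assumes r: "prime r" and d: "of_nat r = d * w" "w \<in> subring_gen c"
    and gen: "gcong c d (\<sigma> c) (c ^ (r ^ j))"
    and \<sigma>c: "\<sigma> c \<in> subring_gen c"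
    and x: "x \<in> subring_gen c"
  shows "\<sigma> x \<in> subring_gen c \<and> gcong c d (\<sigma> x) (x ^ (r ^ j))"
  using x
proof induction
  case one
  then show ?case by (simp add: hom_one gcong_refl subring_gen.one)
next
  case gen
  then show ?case using assms by simp
next
  case (diff x y)
  then have "gcong c d (\<sigma> x - \<sigma> y) (x ^ (r ^ j) - y ^ (r ^ j))" by (simp add: gcong_diff)
  moreover have "gcong c d ((x - y) ^ (r ^ j)) (x ^ (r ^ j) - y ^ (r ^ j))"
    using gcong_dvd[OF gcong_freshman_iterate[OF r diff(1,2)] d] .
  ultimately show ?case
    using diff by (metis gcong_sym gcong_trans hom_diff subring_gen.diff)
next
  case (mult x y)
  then show ?case
    by (auto simp: hom_mult power_mult_distrib intro!: gcong_mult subring_gen_intros)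
qed

text \<open>
  The elements \<open>a\<close> with \<open>a * \<sigma> X \<in> X R\<close> form an ideal. Modulo \<open>d\<close> the power \<open>X ^ k\<close> is idempotent;
  where it is \<open>1\<close> the ideal contains the unit \<open>X\<close>, and on the complementary part
  \<open>(1 - X ^ k) * X\<close> can be divided by \<open>d\<close>, so that induction applies.
\<close>

lemma (in ring_hom_fun) denominator_gcong:
  assumes closed: "\<And>x. x \<in> subring_gen c \<Longrightarrow> \<sigma> x \<in> subring_gen c"
    and d: "d \<in> subring_gen c" and cancel: "\<And>x y. d * x = d * y \<Longrightarrow> x = y"
    and \<sigma>d: "\<sigma> d = v * d" "v \<in> subring_gen c"
    and frob: "\<And>x. x \<in> subring_gen c \<Longrightarrow> gcong c d (\<sigma> x) (x ^ h)"
    and period: "\<And>x. x \<in> subring_gen c \<Longrightarrow> gcong c d (x ^ Suc k) x" and k: "k \<ge> 1"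
    and R: "X \<in> subring_gen c" "Z \<in> subring_gen c" "m \<in> subring_gen c"
    and XZ: "X * Z = d ^ f * m"
  shows "\<exists>a\<in>subring_gen c. \<exists>b\<in>subring_gen c. a * \<sigma> X = b * X \<and> gcong c d a (m ^ k)"
  using R XZ
proof (induction f arbitrary: X m)
  case 0
  show ?case
  proof (intro bexI conjI)
    show "m ^ k * \<sigma> X = (m ^ (k - 1) * Z * \<sigma> X) * X"
      using 0(4) k by (cases k) (auto simp: algebra_simps)
    show "gcong c d (m ^ k) (m ^ k)" by (rule gcong_refl)
  qed (use 0 closed in \<open>auto intro!: subring_gen_intros\<close>)
next
  case (Suc f)
  define E where "E = X ^ k"
  have ER: "E \<in> subring_gen c" using Suc by (auto simp: E_def intro: subring_gen_intros)
  have "gcong c d X (X ^ Suc k)" using period[OF Suc.prems(1)] by (rule gcong_sym)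
  then obtain X' where X': "X' \<in> subring_gen c" "(1 - E) * X = d * X'"
    unfolding gcong_def E_def by (auto simp: algebra_simps)
  have "d * (X' * Z) = (1 - E) * (X * Z)"
    using X'(2) by (metis mult.assoc)
  also have "\<dots> = d * (d ^ f * ((1 - E) * m))"
    by (simp add: Suc.prems(4) algebra_simps)
  finally have "X' * Z = d ^ f * ((1 - E) * m)" by (rule cancel)
  then obtain a b where ab: "a \<in> subring_gen c" "b \<in> subring_gen c" "a * \<sigma> X' = b * X'"
      "gcong c d a (((1 - E) * m) ^ k)"
    using Suc.IH[of X' "(1 - E) * m"] X' Suc.prems ER by (auto intro: subring_gen_intros)
  have E1: "1 - E \<in> subring_gen c" using ER by (intro subring_gen_intros)
  \<comment> \<open>Since \<open>\<sigma> d\<close> is a multiple of \<open>d\<close>, the factor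
    \<open>d\<close> that was divided out returns and turns \<open>b * X'\<close> into a multiple of
    \<open>X\<close>.\<close>
  have "\<sigma> (1 - E) * \<sigma> X = v * d * \<sigma> X'"
    using X'(2) \<sigma>d(1) hom_mult by metis
  then have "a * \<sigma> (1 - E) * \<sigma> X = v * d * (a * \<sigma> X')" by (simp add: algebra_simps)
  also have "\<dots> = v * b * ((1 - E) * X)" unfolding X'(2) ab(3) by (simp add: algebra_simps)
  finally have eq1: "a * \<sigma> (1 - E) * \<sigma> X = v * b * (1 - E) * X" by (simp add: algebra_simps)
  have eq2: "E * m ^ k * \<sigma> X = (X ^ (k - 1) * m ^ k * \<sigma> X) * X"
    using k by (cases k) (auto simp: E_def algebra_simps)
  have EE: "gcong c d (E * E) E"
  proof -
    have "gcong c d (X ^ (k - 1) * X ^ Suc k) (X ^ (k - 1) * X)"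
      using period[OF Suc.prems(1)] Suc.prems(1)
      by (intro gcong_mult gcong_refl) (auto intro: subring_gen_intros)
    then show ?thesis using k by (cases k) (auto simp: E_def power_add[symmetric] algebra_simps simp flip: power_Suc)
  qed
  have idem: "gcong c d ((1 - E) * (1 - E)) (1 - E)"
  proof -
    have "(1 - E) * (1 - E) = (1 - E - E) + E * E" by (simp add: algebra_simps)
    moreover have "gcong c d ((1 - E - E) + E * E) ((1 - E - E) + E)"
      using EE by (intro gcong_add gcong_refl)
    ultimately show ?thesis by simp
  qed
  have idem_power: "gcong c d ((1 - E) ^ Suc n) (1 - E)" for n
  proof (induction n)
    case 0
    show ?case by (simp add: gcong_refl)
  next
    case (Suc n)
    have "gcong c d ((1 - E) * (1 - E) ^ Suc n) ((1 - E) * (1 - E))"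
      using Suc E1 by (intro gcong_mult gcong_refl) (auto intro: subring_gen_intros)
    then show ?case using idem gcong_trans by fastforce
  qed
  have "gcong c d (a * \<sigma> (1 - E)) (((1 - E) * m) ^ k * (1 - E) ^ h)"
    using ab frob[OF E1] E1 Suc.prems by (intro gcong_mult) (auto intro: subring_gen_intros)
  moreover have "((1 - E) * m) ^ k * (1 - E) ^ h = (1 - E) ^ Suc (k - 1 + h) * m ^ k"
    proof -
    have "Suc (k - 1 + h) = k + h" using k by simp
    then show ?thesis by (simp only: power_mult_distrib power_add mult_ac)
  qed
  moreover have "gcong c d ((1 - E) ^ Suc (k - 1 + h) * m ^ k) ((1 - E) * m ^ k)"
    using Suc.prems E1 by (intro gcong_mult gcong_refl idem_power) (auto intro: subring_gen_intros)
  ultimately have "gcong c d (a * \<sigma> (1 - E)) ((1 - E) * m ^ k)" using gcong_trans by metis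
  then have *: "gcong c d (a * \<sigma> (1 - E) + E * m ^ k) ((1 - E) * m ^ k + E * m ^ k)"
    by (intro gcong_add gcong_refl)
  \<comment> \<open>The denominators of the two parts are \<open>(1 - E) * m ^ k\<close> and
    \<open>E * m ^ k\<close> modulo \<open>d\<close>, so their sum is again
    \<open>m ^ k\<close>.\<close>
  show ?case
  proof (intro bexI conjI)
    show "(a * \<sigma> (1 - E) + E * m ^ k) * \<sigma> X =
        (v * b * (1 - E) + X ^ (k - 1) * m ^ k * \<sigma> X) * X"
      using eq1 eq2 by (simp add: distrib_right)
    show "gcong c d (a * \<sigma> (1 - E) + E * m ^ k) (m ^ k)"
      using * by (simp add: algebra_simps)
  qed (use ab E1 ER closed Suc.prems \<sigma>d in \<open>auto intro!: subring_gen_intros\<close>)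
qed

section \<open>Geometric sums and lifting the exponent\<close>

definition geo_sum :: "nat \<Rightarrow> nat \<Rightarrow> nat" where
  "geo_sum t k = (\<Sum>i<k. t ^ i)"

lemma geo_sum_Suc: "geo_sum t (Suc k) = geo_sum t k + t ^ k"
  by (simp add: geo_sum_def)

lemma geo_sum_add: "geo_sum t (m + n) = geo_sum t m + t ^ m * geo_sum t n"
  by (induction n) (auto simp: geo_sum_def power_add algebra_simps)

lemma geo_sum_mult: "geo_sum t (m * n) = geo_sum t m * geo_sum (t ^ m) n"
proof (induction n)
  case 0
  show ?case by (simp add: geo_sum_def)
next
  case (Suc n)
  have "geo_sum t (m * Suc n) = geo_sum t (m * n + m)" by (simp add: add.commute)
  also have "\<dots> = geo_sum t m * geo_sum (t ^ m) n + t ^ (m * n) * geo_sum t m"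
    by (simp add: geo_sum_add Suc.IH)
  also have "\<dots> = geo_sum t m * geo_sum (t ^ m) (Suc n)"
    by (simp add: geo_sum_Suc algebra_simps power_mult[symmetric])
  finally show ?case .
qed

lemma power_eq_geo_sum: "(1 + y) ^ k = 1 + y * geo_sum (1 + y) k"
  by (induction k) (auto simp: geo_sum_def algebra_simps)

lemma geo_sum_cong: "[geo_sum (1 + y) k = k] (mod y)"
proof (induction k)
  case (Suc k)
  have "[(1 + y) ^ k = 1] (mod y)"
    by (simp only: power_eq_geo_sum cong_def mod_mult_self2)
  from cong_add[OF Suc this] show ?case by (simp add: geo_sum_Suc)
qed (simp add: geo_sum_def)

lemma geo_sum_cong_square: "[geo_sum (1 + y) k = k + y * (\<Sum>i<k. i)] (mod y ^ 2)"
proof (induction k)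
  case (Suc k)
  have "[(1 + y) ^ k = 1 + y * k] (mod y ^ 2)"
    unfolding power_eq_geo_sum power2_eq_square by (intro cong_add cong_refl cong_cmult_leftI geo_sum_cong)
  from cong_add[OF Suc this] show ?case by (simp add: geo_sum_Suc algebra_simps)
qed (simp add: geo_sum_def)

lemma coprimeI_by_prime:
  fixes a b :: nat
  assumes "\<And>l. prime l \<Longrightarrow> l dvd b \<Longrightarrow> \<not> l dvd a"
  shows "coprime a b"
proof (rule coprimeI)
  fix m assume "m dvd a" "m dvd b"
  then show "is_unit m" using assms prime_factor_nat[of m] by (metis dvd_trans nat_dvd_1_iff_1)
qed

text \<open>At a prime \<open>l' \<noteq> l\<close> of \<open>K\<close> the sum is congruent to
  \<open>l\<close>, hence a unit. Modulo \<open>l ^ 2\<close> it is congruent to \<open>l\<close>: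
  for odd \<open>l\<close> because \<open>l\<close> divides both \<open>y\<close> and the triangular
  number \<open>\<Sum>i<l. i\<close>, for \<open>l = 2\<close> because it equals
  \<open>2 + y\<close> with \<open>4 dvd y\<close>.\<close>

lemma geo_sum_prime:
  fixes K y l :: nat
  assumes K: "\<And>l. prime l \<Longrightarrow> l dvd K \<Longrightarrow> l dvd y" and 4: "even K \<Longrightarrow> 4 dvd y"
    and l: "prime l" "l dvd K" 
  obtains c where "geo_sum (1 + y) l = l * c" "coprime c K"
proof -
  have ly: "l dvd y" using K[OF l] .
  have "[geo_sum (1 + y) l = l] (mod l)" by (rule cong_dvd_modulus_nat[OF geo_sum_cong ly])
  then have "l dvd geo_sum (1 + y) l" by (simp add: cong_def mod_eq_0_iff_dvd)
  then obtain c where c: "geo_sum (1 + y) l = l * c" by blast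
  have "\<not> l' dvd c" if l': "prime l'" "l' dvd K" for l'
  proof
    assume d: "l' dvd c"
    show False
    proof (cases "l' = l")
      case False
      have "l' dvd geo_sum (1 + y) l" using c d by simp
      moreover have "[geo_sum (1 + y) l = l] (mod l')"
        by (rule cong_dvd_modulus_nat[OF geo_sum_cong K[OF l']])
      ultimately have "l' dvd l" by (simp add: cong_dvd_iff)
      then show False using l(1) l'(1) False primes_dvd_imp_eq by blast
    next
      case True
      have d2: "l ^ 2 dvd geo_sum (1 + y) l" using c d True by (simp add: power2_eq_square)
      show False
      proof (cases "l = 2")
        case True
        have "geo_sum (1 + y) l = 2 + y" using True by (simp add: geo_sum_def numeral_2_eq_2)
        then have "4 dvd 2 + y" using d2 True by simp
        moreover have "4 dvd y" using 4 l True by simp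
        ultimately have "(4::nat) dvd 2" using dvd_add_left_iff by blast
        then show False by simp
      next
        case False
        then have "odd l" using l(1) primes_dvd_imp_eq two_is_prime_nat by blast
        have g: "2 * (\<Sum>i<n. i) = n * (n - 1)" for n :: nat
          by (induction n) (auto simp: algebra_simps split: nat_diff_split)
        have "l dvd 2 * (\<Sum>i<l. i)" unfolding g by simp
        then have "l dvd (\<Sum>i<l. i)"
          using \<open>odd l\<close> by (metis coprime_dvd_mult_right_iff coprime_right_2_iff_odd)
        then have "l ^ 2 dvd y * (\<Sum>i<l. i)" using ly by (simp add: power2_eq_square mult_dvd_mono)
        moreover have "[geo_sum (1 + y) l = l + y * (\<Sum>i<l. i)] (mod l ^ 2)"
          by (rule cong_dvd_modulus_nat[OF geo_sum_cong_square dvd_power_same[OF ly]])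
        ultimately have "l ^ 2 dvd l"
          using d2 by (metis cong_dvd_iff dvd_add_left_iff)
        then have "l * l dvd l * 1" by (simp add: power2_eq_square)
        then have "l dvd 1" using dvd_times_left_cancel_iff[of l l 1] prime_gt_0_nat[OF l(1)] by simp
        then show False using l(1) by simp
      qed
    qed
  qed
  then have "coprime c K" 
    by (metis coprimeI_by_prime)
  then show ?thesis using that c by blast
qed

text \<open>A form of the lifting-the-exponent lemma: for such \<open>y\<close> the valuations of
  \<open>((1 + y) ^ d - 1) / y\<close> and \<open>d\<close> at the primes dividing \<open>K\<close> coincide.\<close>

lemma dvd_geo_sum_imp_dvd:
  fixes K y :: nat
  assumes "K > 0" "\<And>l. prime l \<Longrightarrow> l dvd K \<Longrightarrow> l dvd y" "even K \<Longrightarrow> 4 dvd y"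
    and "K dvd geo_sum (1 + y) d"
  shows "K dvd d"
  using assms
proof (induction K arbitrary: y d rule: less_induct)
  case (less K)
  show ?case
  proof (cases "K = 1")
    case False
    then obtain l where l: "prime l" "l dvd K" using prime_factor_nat by blast
    then obtain K1 where K1: "K = l * K1" by blast
    have "l dvd y" using less.prems(2)[OF l] .
    have "[geo_sum (1 + y) d = d] (mod l)" by (rule cong_dvd_modulus_nat[OF geo_sum_cong \<open>l dvd y\<close>])
    then have "l dvd d" using less.prems(4) l by (metis cong_dvd_iff dvd_trans)
    then obtain d1 where d1: "d = l * d1" by blast
    obtain c where c: "geo_sum (1 + y) l = l * c" "coprime c K"
      using geo_sum_prime[OF less.prems(2,3) l] by blast
    \<comment> \<open>Chosen so that \<open>(1 + y) ^ l = 1 + y1\<close>, the base with which the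
      induction continues after one factor \<open>l\<close> is split off.\<close>
    define y1 where "y1 = y * (l * c)"
    have "geo_sum (1 + y) d = l * c * geo_sum (1 + y1) d1"
      unfolding d1 geo_sum_mult c(1) power_eq_geo_sum y1_def by simp
    then have "l * K1 dvd l * (c * geo_sum (1 + y1) d1)" using less.prems(4) K1 by (simp add: mult.assoc)
    then have "K1 dvd c * geo_sum (1 + y1) d1"
      using dvd_times_left_cancel_iff[of l] prime_gt_0_nat[OF l(1)] by simp
    moreover have "coprime K1 c" using c(2) K1 by (simp add: coprime_commute)
    ultimately have *: "K1 dvd geo_sum (1 + y1) d1" by (simp add: coprime_dvd_mult_right_iff)
    have "K1 dvd d1"
    proof (rule less.IH[OF _ _ _ _ *])
      show "K1 < K" "K1 > 0" using less.prems(1) K1 prime_gt_1_nat[OF l(1)] by auto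
      show "l' dvd y1" if "prime l'" "l' dvd K1" for l'
        using less.prems(2)[OF that(1)] that K1 by (simp add: y1_def)
      show "4 dvd y1" if "even K1" using less.prems(3) that K1 by (simp add: y1_def)
    qed
    then show ?thesis using K1 d1 by simp
  qed simp
qed

text \<open>Two values differ by a unit modulo \<open>K\<close> times
  \<open>geo_sum (1 + y) (j - i)\<close>, which \<open>K\<close> can divide only if it divides
  \<open>j - i\<close>. The shift \<open>c\<close> allows positive exponents to be enforced.\<close>

lemma geo_sum_bij_betw:
  fixes K y :: nat
  assumes "K > 0" "\<And>l. prime l \<Longrightarrow> l dvd K \<Longrightarrow> l dvd y" "even K \<Longrightarrow> 4 dvd y"
  shows "bij_betw (\<lambda>k. geo_sum (1 + y) (c + k) mod K) {..<K} {..<K}"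
proof -
  have cop: "coprime K (1 + y)"
  proof (rule coprimeI)
    fix m assume m: "m dvd K" "m dvd 1 + y"
    show "is_unit m"
    proof (rule ccontr)
      assume "\<not> is_unit m"
      then obtain l where "prime l" "l dvd m" using prime_factor_nat by auto
      then have "l dvd K" "l dvd 1 + y" using m by (auto elim: dvd_trans)
      then have "l dvd y" "l dvd 1 + y" using assms(2) \<open>prime l\<close> by auto
      then show False using \<open>prime l\<close> by (metis dvd_add_left_iff not_prime_unit)
    qed
  qed
  have inj: False if "i < j" "j < K"
    "geo_sum (1 + y) (c + i) mod K = geo_sum (1 + y) (c + j) mod K" for i j
  proof -
    have "geo_sum (1 + y) (c + j) = geo_sum (1 + y) (c + i) + (1 + y) ^ (c + i) * geo_sum (1 + y) (j - i)"
      using geo_sum_add[of "1 + y" "c + i" "j - i"] that(1) by simp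
    then have "[geo_sum (1 + y) (c + i) + (1 + y) ^ (c + i) * geo_sum (1 + y) (j - i) =
        geo_sum (1 + y) (c + i) + 0] (mod K)"
      using that(3) by (simp add: cong_def)
    then have "K dvd (1 + y) ^ (c + i) * geo_sum (1 + y) (j - i)"
      using cong_add_lcancel_nat cong_0_iff by blast
    then have "K dvd geo_sum (1 + y) (j - i)"
      using cop by (simp add: coprime_dvd_mult_right_iff)
    then have "K dvd j - i" using dvd_geo_sum_imp_dvd[OF assms] by simp
    then show False using that by (auto dest: dvd_imp_le)
  qed
  have "inj_on (\<lambda>k. geo_sum (1 + y) (c + k) mod K) {..<K}"
    unfolding inj_on_def using inj by (metis lessThan_iff linorder_neqE_nat)
  moreover have "(\<lambda>k. geo_sum (1 + y) (c + k) mod K) ` {..<K} \<subseteq> {..<K}" using assms(1) by auto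
  ultimately show ?thesis
    by (metis bij_betw_def endo_inj_surj finite_lessThan)
qed

text \<open>With \<open>y = r ^ e - 1\<close> the powers of \<open>r ^ e\<close> are
  \<open>1 + y * geo_sum (1 + y) k\<close>, and these geometric sums meet every residue modulo
  \<open>K\<close>. One \<open>y\<close> thus serves all \<open>K\<close> composed of primes of
  \<open>W\<close>. For \<open>K\<close> the part of \<open>N\<close> prime to \<open>r\<close>, the
  conclusion says that the automorphism for \<open>t\<close> fixes the primes above
  \<open>r\<close>.\<close>

lemma exists_power_cong:
  fixes r W :: nat
  assumes "r > 1" "W > 0" "coprime r W"
  shows "\<exists>y>0. \<forall>t K i. [t = 1] (mod y) \<longrightarrow> t > 0 \<longrightarrow> K > 0 \<longrightarrow> K dvd W ^ i \<longrightarrow> (\<exists>j\<ge>1. [t = r ^ j] (mod K))"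
proof -
  \<comment> \<open>The square makes \<open>4\<close> divide \<open>y\<close> when \<open>W\<close>
    is even, as lifting the exponent at \<open>2\<close> requires.\<close>
  define e where "e = totient (W ^ 2)"
  have e: "e > 0" using assms by (simp add: e_def)
  have "[r ^ e = 1] (mod W ^ 2)" unfolding e_def using assms by (intro euler_theorem) auto
  define y where "y = r ^ e - 1"
  have re: "r ^ e > 1" using assms e by (metis one_less_power)
  then have ry: "r ^ e = 1 + y" by (simp add: y_def)
  have Wy: "W ^ 2 dvd y" using \<open>[r ^ e = 1] (mod W ^ 2)\<close> re
    by (metis cong_altdef_nat' less_imp_le_nat y_def cong_sym cong_to_1_nat)
  have "\<exists>j\<ge>1. [t = r ^ j] (mod K)" if t: "[t = 1] (mod y)" "t > 0" and K: "K > 0" "K dvd W ^ i" for t K i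
  proof -
    have lW: "l dvd W" if "prime l" "l dvd K" for l
      using that K by (meson dvd_trans prime_dvd_power)
    have "y dvd t - 1" using t cong_to_1_nat by blast
    then obtain z where "t - 1 = y * z" by blast
    then have z: "t = 1 + y * z" using t(2) by simp
    have "even K \<Longrightarrow> 4 dvd y"
    proof -
      assume "even K"
      then have "2 ^ 2 dvd W ^ 2" using lW[of 2] by (intro dvd_power_same) auto
      then show "4 dvd y" using Wy by (auto intro: dvd_trans)
    qed
    moreover have "l dvd y" if "prime l" "l dvd K" for l
      using lW[OF that] Wy by (metis dvd_mult2 dvd_trans power2_eq_square)
    ultimately have "bij_betw (\<lambda>k. geo_sum (1 + y) (1 + k) mod K) {..<K} {..<K}"
      by (intro geo_sum_bij_betw K)
    moreover have "z mod K \<in> {..<K}" using K by simp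
    ultimately obtain k where k: "z mod K = geo_sum (1 + y) (1 + k) mod K"
      unfolding bij_betw_def by blast
    have "[1 + y * z = 1 + y * geo_sum (1 + y) (1 + k)] (mod K)"
      using k by (intro cong_add cong_mult) (auto simp: cong_def)
    then have "[t = (1 + y) ^ (1 + k)] (mod K)" unfolding z power_eq_geo_sum .
    then have "[t = r ^ (e * (1 + k))] (mod K)" unfolding ry[symmetric] power_mult .
    then show ?thesis using e by (intro exI[of _ "e * (1 + k)"]) auto
  qed
  moreover have "y > 0" using re by (simp add: y_def)
  ultimately show ?thesis by blast
qed

section \<open>The cyclotomic ring\<close>

lemma power_fun_apply: "(f ^ n) x = f x ^ n" for f :: "'b \<Rightarrow> 'c::comm_ring_1"
  by (induction n) auto

text \<open>As simplification rules these would also rewrite elements of the ring that occur eta-expanded.\<close>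

lemmas fun_ops = plus_fun_apply times_fun_apply zero_fun_apply one_fun_apply minus_apply
  of_nat_fun_apply power_fun_apply

declare plus_fun_apply [simp del] times_fun_apply [simp del] zero_fun_apply [simp del]
  one_fun_apply [simp del] minus_apply [simp del] of_nat_fun_apply [simp del]

lemma zeta_eq_cis: "zeta N = cis (2 * pi / real N)"
  by (simp add: zeta_def cis_conv_exp mult_ac)

lemma zeta_power: "zeta N ^ k = cis (2 * pi * real k / real N)"
  by (simp add: zeta_eq_cis DeMoivre mult_ac)

lemma cmod_zeta_power [simp]: "cmod (zeta N ^ k) = 1"
  by (simp add: zeta_power)

lemma zeta_nonzero [simp]: "zeta N \<noteq> 0"
  by (simp add: zeta_def)

lemma zeta_power_N: "N > 0 \<Longrightarrow> zeta N ^ N = 1"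
  by (simp add: zeta_power)

lemma zeta_power_mod: "N > 0 \<Longrightarrow> zeta N ^ (k mod N) = zeta N ^ k"
proof -
  assume "N > 0"
  have "zeta N ^ k = zeta N ^ (N * (k div N) + k mod N)" by simp
  also have "\<dots> = zeta N ^ (k mod N)" using zeta_power_N[OF \<open>N > 0\<close>] by (simp only: power_add power_mult) simp
  finally show ?thesis by simp
qed

lemma zeta_power_eq_iff: "N > 0 \<Longrightarrow> zeta N ^ a = zeta N ^ b \<longleftrightarrow> [a = b] (mod N)"
proof -
  assume N: "N > 0"
  have "inj_on (\<lambda>k. zeta N ^ k) {..<N}"
    using bij_betw_roots_unity[OF N] unfolding bij_betw_def zeta_power by blast
  then have "zeta N ^ (a mod N) = zeta N ^ (b mod N) \<longleftrightarrow> a mod N = b mod N"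
    using N by (auto dest: inj_onD)
  then show ?thesis using N by (simp add: zeta_power_mod cong_def)
qed

lemma zeta_power_eq_1_iff: "N > 0 \<Longrightarrow> zeta N ^ a = 1 \<longleftrightarrow> N dvd a"
  using zeta_power_eq_iff[of N a 0] by (simp add: cong_0_iff)

text \<open>Elements of the cyclotomic ring are functions on all naturals, but only the values at units
  matter: \<open>unit_rep\<close> makes the value at every non-unit equal to the value at \<open>1\<close>.\<close>

definition unit_rep :: "nat \<Rightarrow> nat \<Rightarrow> nat" where
  "unit_rep N u = (if coprime u N then u else 1)"

definition chi :: "nat \<Rightarrow> nat \<Rightarrow> complex" where
  "chi N u = zeta N ^ unit_rep N u"

abbreviation cyc :: "nat \<Rightarrow> (nat \<Rightarrow> complex) set" where
  "cyc N \<equiv> subring_gen (chi N)"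

text \<open>The automorphism sending the root of unity to its \<open>t\<close>-th power is a mere
  change of argument. For \<open>t\<close> coprime to \<open>N\<close>, \<open>unit_rep\<close>
  keeps that argument a unit even if \<open>u\<close> is not.\<close>

definition gal :: "nat \<Rightarrow> nat \<Rightarrow> (nat \<Rightarrow> complex) \<Rightarrow> nat \<Rightarrow> complex" where
  "gal N t F u = F (t * unit_rep N u)"

lemma coprime_unit_rep [simp]: "coprime (unit_rep N u) N"
  by (simp add: unit_rep_def)

lemma unit_rep_coprime [simp]: "coprime u N \<Longrightarrow> unit_rep N u = u"
  by (simp add: unit_rep_def)

lemma chi_power_apply: "(chi N ^ j) u = zeta N ^ (j * unit_rep N u)"
  by (simp add: fun_ops chi_def power_mult[symmetric] mult.commute)

lemma chi_power_eq: "N > 0 \<Longrightarrow> [a = b] (mod N) \<Longrightarrow> chi N ^ a = chi N ^ b"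
  by (rule ext) (auto simp: chi_power_apply zeta_power_eq_iff intro!: cong_scalar_right)

lemma ring_hom_gal: "ring_hom_fun (gal N t)"
  by unfold_locales (auto simp: gal_def fun_eq_iff fun_ops)

lemma gal_chi: "coprime t N \<Longrightarrow> gal N t (chi N) = chi N ^ t"
  by (rule ext) (simp add: gal_def chi_power_apply chi_def)

lemma gal_power: "gal N t (F ^ k) = gal N t F ^ k"
  by (rule ext) (simp add: gal_def fun_ops)

lemma gal_gal: "coprime s N \<Longrightarrow> gal N s (gal N t F) = gal N (s * t) F"
  by (rule ext) (simp add: gal_def mult_ac)

lemma gal_closed:
  assumes "coprime t N" "F \<in> cyc N"
  shows "gal N t F \<in> cyc N"
proof -
  interpret ring_hom_fun "gal N t" by (rule ring_hom_gal)
  show ?thesis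
    using assms(2)
    by induction (auto simp: hom_one hom_diff hom_mult gal_chi assms(1) intro: subring_gen_intros)
qed

lemma cyc_cong:
  assumes "N > 0" "F \<in> cyc N" "[unit_rep N u = unit_rep N v] (mod N)"
  shows "F u = F v"
  using assms(2) by induction (use assms in \<open>auto simp: chi_def zeta_power_eq_iff fun_ops\<close>)

lemma gal_1: "N > 0 \<Longrightarrow> F \<in> cyc N \<Longrightarrow> gal N 1 F = F"
  unfolding gal_def by (rule ext) (auto intro!: cyc_cong[of N])

lemma coprime_pred: "N > 0 \<Longrightarrow> coprime (N - 1) (N::nat)"
  by (metis coprime_diff_one_left_nat)

text \<open>\<open>N - 1\<close> represents \<open>-1\<close> modulo \<open>N\<close>.\<close>

lemma cyc_cnj:
  assumes "N > 0" "F \<in> cyc N"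
  shows "cnj (F u) = gal N (N - 1) F u"
  using assms(2)
proof induction
  case gen
  have "cnj (zeta N ^ k) * zeta N ^ k = 1" for k
    using complex_norm_square[of "zeta N ^ k"] by (simp add: mult.commute)
  moreover have "zeta N ^ ((N - 1) * k) * zeta N ^ k = 1" for k
  proof -
    have "(N - 1) * k + k = N * k" using assms(1) by (cases N) auto
    then show ?thesis
      using zeta_power_eq_1_iff[OF assms(1), of "N * k"] by (simp only: power_add[symmetric]) simp
  qed
  ultimately have "cnj (zeta N ^ k) = zeta N ^ ((N - 1) * k)" for k
    by (metis mult_cancel_right power_not_zero zeta_nonzero)
  then show ?case
    unfolding gal_chi[OF coprime_pred[OF assms(1)]] chi_power_apply by (simp add: chi_def)
qed (auto simp: gal_def fun_ops)

section \<open>Integrality of traces, and its consequences for small and unimodular elements\<close>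

lemma sum_zeta_powers:
  assumes "N > 0" "d dvd N"
  shows "(\<Sum>u | u < N \<and> d dvd u. zeta N ^ (u * j)) \<in> \<int>"
proof -
  obtain M where M: "N = d * M" using assms by blast
  then have d: "d > 0" "M > 0" using assms by auto
  have "(\<Sum>u | u < N \<and> d dvd u. zeta N ^ (u * j)) = (\<Sum>v<M. (zeta N ^ (d * j)) ^ v)"
    by (rule sum.reindex_bij_witness[of _ "\<lambda>v. d * v" "\<lambda>u. u div d"])
      (use d M in \<open>auto simp: power_mult[symmetric] mult_ac\<close>)
  also have "\<dots> \<in> \<int>"
  proof (cases "zeta N ^ (d * j) = 1")
    case False
    have "(zeta N ^ (d * j)) ^ M = 1"
      using zeta_power_eq_1_iff[OF assms(1), of "d * j * M"] M
      by (simp add: power_mult[symmetric] mult_ac)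
    then show ?thesis using False by (simp add: sum_gp_strict)
  qed simp
  finally show ?thesis .
qed

text \<open>Inclusion-exclusion, one prime at a time: the multiples of \<open>d\<close> divisible by
  \<open>p\<close> are the multiples of \<open>lcm d p\<close>, which is why \<open>d\<close> stays
  arbitrary.\<close>

lemma sum_zeta_powers_sieve:
  assumes "N > 0" "finite A" "d dvd N" "A \<subseteq> {p. prime p \<and> p dvd N}"
  shows "(\<Sum>u | u < N \<and> d dvd u \<and> (\<forall>p\<in>A. \<not> p dvd u). zeta N ^ (u * j)) \<in> \<int>"
  using assms(2,3,4)
proof (induction A arbitrary: d rule: finite_induct)
  case empty
  then show ?case using sum_zeta_powers[OF assms(1)] by simp
next
  case (insert p A)
  let ?f = "\<lambda>u. zeta N ^ (u * j)"
  have eq: "{u. u < N \<and> d dvd u \<and> (\<forall>p\<in>A. \<not> p dvd u)} =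
     {u. u < N \<and> d dvd u \<and> (\<forall>q\<in>insert p A. \<not> q dvd u)} \<union>
     {u. u < N \<and> lcm d p dvd u \<and> (\<forall>p\<in>A. \<not> p dvd u)}" by auto
  let ?B = "\<Sum>u | u < N \<and> d dvd u \<and> (\<forall>q\<in>insert p A. \<not> q dvd u). ?f u"
  let ?C = "\<Sum>u | u < N \<and> lcm d p dvd u \<and> (\<forall>p\<in>A. \<not> p dvd u). ?f u"
  have "(\<Sum>u | u < N \<and> d dvd u \<and> (\<forall>p\<in>A. \<not> p dvd u). ?f u) = ?B + ?C"
    unfolding eq by (rule sum.union_disjoint) auto
  moreover have "(\<Sum>u | u < N \<and> d dvd u \<and> (\<forall>p\<in>A. \<not> p dvd u). ?f u) \<in> \<int>"
    using insert.prems by (intro insert.IH) auto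
  ultimately have "?B + ?C \<in> \<int>" by simp
  moreover have "?C \<in> \<int>" using insert.prems by (intro insert.IH) auto
  ultimately have "?B + ?C - ?C \<in> \<int>" by (rule Ints_diff)
  then show ?case by simp
qed

text \<open>Traces of powers of \<open>chi N\<close> are Ramanujan sums, integral by the sieve over
  the primes dividing \<open>N\<close>; additivity does the rest.\<close>

lemma trace_integer:
  assumes N: "N > 0" and F: "F \<in> cyc N"
  shows "(\<Sum>u | u < N \<and> coprime u N. F u) \<in> \<int>"
proof (rule subring_gen_additive[OF _ F, where G = "\<int>"])
  fix j
  have "coprime u N \<longleftrightarrow> (\<forall>p\<in>{p. prime p \<and> p dvd N}. \<not> p dvd u)" for u
    using coprimeI_by_prime[of N u] by (metis coprime_common_divisor mem_Collect_eq not_prime_unit)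
  then have "(\<Sum>u | u < N \<and> coprime u N. zeta N ^ (u * j)) \<in> \<int>"
    using sum_zeta_powers_sieve[OF N, of "{p. prime p \<and> p dvd N}" 1 j] N by simp
  moreover have "(\<Sum>u | u < N \<and> coprime u N. (chi N ^ j) u) = (\<Sum>u | u < N \<and> coprime u N. zeta N ^ (u * j))"
    by (rule sum.cong) (auto simp: chi_def power_mult fun_ops)
  ultimately show "(\<Sum>u | u < N \<and> coprime u N. (chi N ^ j) u) \<in> \<int>" by simp
qed (auto simp: sum_subtractf fun_ops)

text \<open>The traces of the powers of \<open>\<bar>z\<bar>\<^sup>2\<close> are nonnegative integers tending to \<open>0\<close>.\<close>

lemma cyc_small_imp_zero:
  assumes N: "N > 0" and z: "z \<in> cyc N" and small: "\<And>u. cmod (z u) < 1"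
  shows "z = 0"
proof -
  let ?U = "{u. u < N \<and> coprime u N}"
  define h where "h = z * gal N (N - 1) z"
  have h: "h \<in> cyc N" unfolding h_def
    using gal_closed[OF coprime_pred[OF N] z] z by (intro subring_gen_intros)
  have hu: "h u = of_real (cmod (z u) ^ 2)" for u
    unfolding h_def by (metis fun_ops(2) cyc_cnj[OF N z] complex_norm_square of_real_power)
  have "(\<lambda>k. \<Sum>u\<in>?U. (cmod (z u) ^ 2) ^ k) \<longlonglongrightarrow> (\<Sum>u\<in>?U. 0)"
    using small by (intro tendsto_sum LIMSEQ_realpow_zero) (auto simp: power_less_one_iff)
  then have "eventually (\<lambda>k. (\<Sum>u\<in>?U. (cmod (z u) ^ 2) ^ k) < 1) sequentially"
    by (intro order_tendstoD) auto
  then obtain k where k: "(\<Sum>u\<in>?U. (cmod (z u) ^ 2) ^ k) < 1"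
    using eventually_sequentially by auto
  have "(\<Sum>u\<in>?U. (h ^ k) u) \<in> \<int>"
    using trace_integer[OF N subring_gen_power[OF h]] .
  also have "(\<Sum>u\<in>?U. (h ^ k) u) = of_real (\<Sum>u\<in>?U. (cmod (z u) ^ 2) ^ k)"
    by (simp add: hu fun_ops)
  finally obtain m where "complex_of_real (\<Sum>u\<in>?U. (cmod (z u) ^ 2) ^ k) = of_int m" by (rule Ints_cases)
  then have m: "(\<Sum>u\<in>?U. (cmod (z u) ^ 2) ^ k) = of_int m"
    by (metis of_real_eq_iff of_real_of_int_eq)
  moreover have "(\<Sum>u\<in>?U. (cmod (z u) ^ 2) ^ k) \<ge> 0" by (intro sum_nonneg) auto
  ultimately have "m = 0" using k by linarith
  then have *: "z u = 0" if "u \<in> ?U" for u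
    using m that sum_nonneg_eq_0_iff[of ?U "\<lambda>u. (cmod (z u) ^ 2) ^ k"] by auto
  show ?thesis
  proof
    fix u
    let ?v = "unit_rep N u mod N"
    have v: "coprime ?v N" using N by simp
    have "z u = z ?v"
      using v by (intro cyc_cong[OF N z]) (auto simp: cong_def)
    then show "z u = 0 u" using * v N by (simp add: fun_ops)
  qed
qed

text \<open>For an odd prime \<open>r\<close> the two sides are congruent modulo \<open>r\<close> but differ by at most \<open>2\<close>.\<close>

lemma cyc_unimodular_gal:
  assumes N: "N > 0" and U: "U \<in> cyc N" and norm: "\<And>u. cmod (U u) = 1"
    and m: "odd m" "coprime m N"
  shows "gal N m U = U ^ m"
proof -
  have prime: "gal N r U = U ^ r" if r: "prime r" "odd r" "coprime r N" for r
  proof -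
    interpret ring_hom_fun "gal N r" by (rule ring_hom_gal)
    have "gcong (chi N) (of_nat r) (gal N r U) (U ^ (r ^ 1))"
      by (rule conjunct2[OF frobenius_gcong[OF r(1), where w = 1]])
        (use r U in \<open>auto simp: gal_chi gcong_refl intro: subring_gen_intros\<close>)
    then obtain z where z: "z \<in> cyc N" "gal N r U - U ^ r = of_nat r * z"
      unfolding gcong_def by auto
    have "r \<noteq> 2" "r \<ge> 2" using r prime_ge_2_nat by auto
    then have r3: "real r \<ge> 3" by linarith
    have "cmod (z u) < 1" for u
    proof -
      have "of_nat r * z u = gal N r U u - U u ^ r" using fun_cong[OF z(2), of u] by (simp add: fun_ops)
      then have "real r * cmod (z u) = cmod (gal N r U u - U u ^ r)" by (metis norm_mult norm_of_nat)
      also have "\<dots> \<le> cmod (gal N r U u) + cmod (U u ^ r)" by (rule norm_triangle_ineq4)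
      also have "\<dots> = 2" by (simp add: gal_def norm norm_power)
      finally have "real r * cmod (z u) \<le> 2" .
      moreover have "3 * cmod (z u) \<le> real r * cmod (z u)" using r3 by (intro mult_right_mono) auto
      ultimately show ?thesis by linarith
    qed
    then have "z = 0" using cyc_small_imp_zero[OF N z(1)] by blast
    then show ?thesis using z(2) by simp
  qed
  show ?thesis
    using m
  proof (induction m rule: prime_divisors_induct)
    case (unit m)
    then show ?case using gal_1[OF N U] by simp
  next
    case (factor r m)
    then have "gal N (r * m) U = gal N r (U ^ m)" by (simp add: gal_gal[symmetric])
    also have "\<dots> = U ^ (r * m)" using prime[of r] factor by (simp add: gal_power power_mult)
    finally show ?case .
  qed simp
qed

section \<open>Divisibility by conjugates\<close>

text \<open>Modulo \<open>1 - chi N ^ K\<close> the generator becomes a \<open>K\<close>-th root of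
  unity.\<close>

lemma gcong_one_chi:
  assumes "N > 0" "N = L * K" "[x = y] (mod K)"
  shows "gcong (chi N) (1 - chi N ^ K) (chi N ^ x) (chi N ^ y)"
proof -
  have *: "gcong (chi N) (1 - chi N ^ K) (chi N ^ x) (chi N ^ (x + K * j))" for x j
  proof -
    have "chi N ^ x - chi N ^ (x + K * j) = chi N ^ x * (1 - (chi N ^ K) ^ j)"
      by (simp add: power_add power_mult right_diff_distrib)
    also have "\<dots> = (1 - chi N ^ K) * (chi N ^ x * (\<Sum>i<j. (chi N ^ K) ^ i))"
      by (simp only: one_diff_power_eq mult_ac)
    finally show ?thesis
      unfolding gcong_def by (intro bexI[where x = "chi N ^ x * (\<Sum>i<j. (chi N ^ K) ^ i)"] subring_gen_intros)
  qed
  show ?thesis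
  proof (cases "x \<le> y")
    case True
    then obtain j where "y = x + K * j"
      using assms(3) by (metis cong_le_nat cong_sym add.commute mult.commute)
    then show ?thesis using * by simp
  next
    case False
    then obtain j where "x = y + K * j"
      using assms(3) by (metis cong_le_nat nat_le_linear add.commute mult.commute)
    then show ?thesis using *[of y j] gcong_sym by simp
  qed
qed

text \<open>A generator of the radical of \<open>r R\<close>, which is \<open>r\<close> itself in the unramified case.\<close>

lemma radical_generator:
  assumes N: "N > 0" "N = r ^ a * K" and r: "prime r" "coprime r K" and t: "coprime t N"
  obtains d v w w' f where
    "d \<in> cyc N" "v \<in> cyc N" "w \<in> cyc N" "w' \<in> cyc N" "\<And>x y. d * x = d * y \<Longrightarrow> x = y"
    "gal N t d = v * d" "of_nat r = d * w" "d ^ f = of_nat r * w'"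
    "\<And>x y. [x = y] (mod K) \<Longrightarrow> gcong (chi N) d (chi N ^ x) (chi N ^ y)"
proof (cases "a = 0")
  case True
  then have NK: "N = K" using N by simp
  show ?thesis
  proof (rule that[of "of_nat r" 1 1 1 1])
    show "x = y" if "of_nat r * x = of_nat r * y" for x y :: "nat \<Rightarrow> complex"
    proof
      fix u
      from fun_cong[OF that, of u] show "x u = y u" using r(1) by (simp add: fun_ops)
    qed
    show "gal N t (of_nat r) = 1 * of_nat r" by (rule ext) (simp add: gal_def fun_ops)
    show "gcong (chi N) (of_nat r) (chi N ^ x) (chi N ^ y)" if "[x = y] (mod K)" for x y
    proof -
      have "chi N ^ x = chi N ^ y" using that NK N(1) by (intro chi_power_eq) auto
      then show ?thesis using gcong_refl by metis
    qed
  qed (simp_all add: subring_gen_intros)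
next
  case False
  \<comment> \<open>The values of \<open>chi N ^ K\<close> are primitive \<open>r ^ a\<close>-th
    roots of unity, as \<open>K\<close> is the part of \<open>N\<close> prime to
    \<open>r\<close>.\<close>
  define d where "d = 1 - chi N ^ K"
  have r2: "r \<ge> 2" using prime_ge_2_nat[OF r(1)] .
  have K: "K > 0" using N by auto
  have chi_d: "gcong (chi N) d (chi N ^ x) (chi N ^ y)" if "[x = y] (mod K)" for x y
    unfolding d_def by (rule gcong_one_chi[OF N that])
  have dR: "d \<in> cyc N" unfolding d_def by (intro subring_gen_intros)
  have nr: "\<not> r dvd unit_rep N u" for u
  proof
    assume "r dvd unit_rep N u"
    moreover have "r dvd N" using N False by (simp add: dvd_mult2)
    ultimately show False
      using coprime_unit_rep[of N u] r(1) by (metis coprime_common_divisor not_prime_unit)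
  qed
  \<comment> \<open>This is a primitive \<open>r\<close>-th root of unity. That it differs from
    \<open>1\<close> shows that \<open>d\<close> vanishes nowhere and, below, that the sum of its
    first \<open>r\<close> powers is \<open>0\<close>.\<close>
  have ne: "zeta N ^ (K * r ^ (a - 1) * unit_rep N u) \<noteq> 1" for u
  proof
    assume "zeta N ^ (K * r ^ (a - 1) * unit_rep N u) = 1"
    then have "N dvd K * r ^ (a - 1) * unit_rep N u" using zeta_power_eq_1_iff[OF N(1)] by simp
    moreover have "N = (K * r ^ (a - 1)) * r" using N(2) False by (cases a) auto
    ultimately have "r dvd unit_rep N u" 
      using K r2 dvd_times_left_cancel_iff[of "K * r ^ (a - 1)" r "unit_rep N u"] by simp
    then show False using nr by simp
  qed
  have dne: "d u \<noteq> 0" for u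
  proof
    assume "d u = 0"
    then have "zeta N ^ (K * unit_rep N u) = 1" by (simp add: d_def minus_apply one_fun_apply chi_power_apply)
    then have "zeta N ^ (K * r ^ (a - 1) * unit_rep N u) = 1"
      by (metis mult.assoc mult.commute power_mult power_one)
    then show False using ne by simp
  qed
  have cancel: "x = y" if "d * x = d * y" for x y
  proof
    fix u
    from fun_cong[OF that, of u] show "x u = y u" using dne[of u] by (simp add: fun_ops)
  qed
  interpret ring_hom_fun "gal N t" by (rule ring_hom_gal)
  have "gal N t d = 1 - (chi N ^ K) ^ t"
    unfolding d_def hom_diff hom_one gal_power gal_chi[OF t] by (simp only: power_mult[symmetric] mult.commute)
  also have "\<dots> = (\<Sum>i<t. (chi N ^ K) ^ i) * d" unfolding d_def one_diff_power_eq by (rule mult.commute)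
  finally have gd: "gal N t d = (\<Sum>i<t. (chi N ^ K) ^ i) * d" .
  define \<omega> where "\<omega> = chi N ^ (K * r ^ (a - 1))"
  \<comment> \<open>All powers of \<open>\<omega>\<close> are \<open>1\<close> modulo
    \<open>d\<close>, so the vanishing sum over \<open>i < r\<close> is congruent to
    \<open>r\<close>, and \<open>d\<close> divides \<open>r\<close>.\<close>
  have "gcong (chi N) d (\<Sum>i<n. \<omega> ^ i) (of_nat n)" for n
  proof (induction n)
    case (Suc n)
    have "gcong (chi N) d (chi N ^ (K * r ^ (a - 1) * n)) (chi N ^ 0)"
      by (rule chi_d) (simp add: cong_0_iff)
    then have "gcong (chi N) d (\<omega> ^ n) 1" by (simp add: \<omega>_def power_mult)
    from gcong_add[OF Suc this] show ?case by (simp add: add.commute)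
  qed (simp add: gcong_refl)
  moreover have "(\<Sum>i<r. \<omega> ^ i) = 0"
  proof
    fix u
    have \<omega>u: "\<omega> u = zeta N ^ (K * r ^ (a - 1) * unit_rep N u)"
      unfolding \<omega>_def chi_power_apply ..
    have eq: "K * r ^ (a - 1) * unit_rep N u * r = N * unit_rep N u" using N(2) False by (cases a) auto
    have "\<omega> u ^ r = 1"
      unfolding \<omega>u power_mult[symmetric] eq zeta_power_eq_1_iff[OF N(1)] by simp
    moreover have "(\<Sum>i<n. \<omega> ^ i) u = (\<Sum>i<n. \<omega> u ^ i)" for n
      by (induction n) (auto simp: fun_ops)
    ultimately show "(\<Sum>i<r. \<omega> ^ i) u = 0 u"
      using ne[of u] by (simp add: \<omega>u sum_gp_strict fun_ops)
  qed
  ultimately have "gcong (chi N) d 0 (of_nat r)" by metis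
  from gcong_sym[OF this] obtain w where w: "w \<in> cyc N" "of_nat r = d * w"
    unfolding gcong_def by auto
  \<comment> \<open>Conversely \<open>r\<close> divides \<open>d ^ (r ^ a)\<close>, because
    \<open>chi N ^ K\<close> has \<open>r ^ a\<close>-th power \<open>1\<close>.\<close>
  have "gcong (chi N) (of_nat r) ((1 - chi N ^ K) ^ (r ^ a)) (1 ^ (r ^ a) - (chi N ^ K) ^ (r ^ a))"
    by (rule gcong_freshman_iterate[OF r(1)]) (intro subring_gen_intros)+
  moreover have "(chi N ^ K) ^ (r ^ a) = 1"
  proof -
    have "chi N ^ N = chi N ^ 0" by (rule chi_power_eq) (use N in \<open>auto simp: cong_0_iff\<close>)
    then show ?thesis using N(2) by (simp add: power_mult[symmetric] mult.commute)
  qed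
  ultimately obtain w' where "w' \<in> cyc N" "d ^ (r ^ a) = of_nat r * w'"
    unfolding gcong_def d_def by auto
  moreover have "(\<Sum>i<t. (chi N ^ K) ^ i) \<in> cyc N" by (intro subring_gen_intros)
  ultimately show ?thesis
    using that[OF dR _ w(1) _ cancel gd w(2) _ chi_d] by metis
qed

section \<open>Denominators of the quotient of \<open>gal N t X\<close> by \<open>X\<close>\<close>

text \<open>The \<open>a\<close> for which \<open>a * gal N t X\<close> is a multiple of
  \<open>X\<close> form the denominator ideal of the quotient; the predicate says that this ideal is
  comaximal with \<open>m\<close>.\<close>

definition denom_mod :: "nat \<Rightarrow> nat \<Rightarrow> (nat \<Rightarrow> complex) \<Rightarrow> nat \<Rightarrow> bool" where
  "denom_mod N t X m \<longleftrightarrow>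
     (\<exists>a\<in>cyc N. \<exists>b\<in>cyc N. a * gal N t X = b * X \<and> gcong (chi N) (of_nat m) a 1)"

text \<open>The new denominator is \<open>1 - (1 - a) * (1 - a')\<close>, the usual witness that
  comaximality passes to products.\<close>

lemma denom_mod_mult:
  assumes "denom_mod N t X m" "denom_mod N t X m'"
  shows "denom_mod N t X (m * m')"
proof -
  obtain a b where a: "a \<in> cyc N" "b \<in> cyc N" "a * gal N t X = b * X" "gcong (chi N) (of_nat m) a 1"
    using assms unfolding denom_mod_def by blast
  obtain a' b' where a': "a' \<in> cyc N" "b' \<in> cyc N" "a' * gal N t X = b' * X" "gcong (chi N) (of_nat m') a' 1"
    using assms unfolding denom_mod_def by blast
  obtain w where w: "w \<in> cyc N" "a - 1 = of_nat m * w" using a(4) unfolding gcong_def by blast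
  obtain w' where w': "w' \<in> cyc N" "a' - 1 = of_nat m' * w'" using a'(4) unfolding gcong_def by blast
  show ?thesis
    unfolding denom_mod_def
  proof (intro bexI conjI)
    have "(a + a' - a * a') * gal N t X = a * gal N t X + a' * gal N t X - a * (a' * gal N t X)"
      by (simp only: distrib_right left_diff_distrib mult.assoc)
    also have "\<dots> = (b + b' - a * b') * X"
      by (simp only: a a' distrib_right left_diff_distrib mult.assoc)
    finally show "(a + a' - a * a') * gal N t X = (b + b' - a * b') * X" .
    have "(a + a' - a * a') - 1 = - ((a - 1) * (a' - 1))" by (simp add: algebra_simps)
    also have "\<dots> = of_nat (m * m') * (- (w * w'))" unfolding w w' by (simp add: mult_ac)
    finally show "gcong (chi N) (of_nat (m * m')) (a + a' - a * a') 1"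
      unfolding gcong_def by (intro bexI[of _ "- (w * w')"]) (use w w' in \<open>auto intro: subring_gen_intros\<close>)
  qed (use a a' in \<open>auto intro!: subring_gen_intros\<close>)
qed

text \<open>\<open>t \<equiv> r ^ j\<close> modulo \<open>K\<close> makes the automorphism a
  Frobenius power modulo \<open>d\<close>. This yields a denominator congruent modulo
  \<open>d\<close> to a power of the \<open>r\<close>-free part of \<open>n\<close>, which is then
  improved to one congruent to \<open>1\<close> modulo \<open>r\<close>.\<close>

lemma denom_mod_prime:
  assumes N: "N > 0" "N = r ^ a * K" and r: "prime r" "coprime r K" and t: "coprime t N"
    and j: "j \<ge> 1" "[t = r ^ j] (mod K)"
    and R: "X \<in> cyc N" "Y \<in> cyc N" and n: "n > 0" and XY: "X * Y = of_nat n"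
  shows "denom_mod N t X r"
proof -
  obtain d v w w' f where d:
    "d \<in> cyc N" "v \<in> cyc N" "w \<in> cyc N" "w' \<in> cyc N" "\<And>x y. d * x = d * y \<Longrightarrow> x = y"
    "gal N t d = v * d" "of_nat r = d * w" "d ^ f = of_nat r * w'"
    "\<And>x y. [x = y] (mod K) \<Longrightarrow> gcong (chi N) d (chi N ^ x) (chi N ^ y)"
    using radical_generator[OF N r t] by metis
  obtain e n' where n': "n = r ^ e * n'" "\<not> r dvd n'"
    using prime_power_canonical[OF r(1) n] by (metis mult.commute)
  define h where "h = r ^ j"
  \<comment> \<open>\<open>Suc k\<close> is a power of \<open>r\<close> congruent to
    \<open>1\<close> modulo \<open>K\<close>, so the Frobenius lemma for the identity map gives
    \<open>x ^ Suc k \<equiv> x\<close> modulo \<open>d\<close>.\<close>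
  define k where "k = h ^ totient K - 1"
  have r2: "r \<ge> 2" using prime_ge_2_nat[OF r(1)] .
  have K: "K > 0" using N by auto
  have "h > 1" unfolding h_def using j r2 by (intro one_less_power) auto
  then have hk: "h ^ totient K > 1" using K by (intro one_less_power) auto
  then have k: "k \<ge> 1" "Suc k = h ^ totient K" by (auto simp: k_def)
  have "coprime h K" using r by (simp add: h_def)
  then have hK: "[Suc k = 1] (mod K)" unfolding k using euler_theorem by simp
  interpret g: ring_hom_fun "gal N t" by (rule ring_hom_gal)
  interpret i: ring_hom_fun "\<lambda>x::nat \<Rightarrow> complex. x" by unfold_locales auto
  have frob: "gcong (chi N) d (gal N t x) (x ^ h)" if "x \<in> cyc N" for x
    unfolding h_def
    by (rule conjunct2[OF g.frobenius_gcong[OF r(1) d(7,3) _ _ that]])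
      (use d(9)[OF j(2)] t in \<open>auto simp: gal_chi intro: subring_gen_intros\<close>)
  have period: "gcong (chi N) d (x ^ Suc k) x" if "x \<in> cyc N" for x
  proof -
    have e: "Suc k = r ^ (j * totient K)" by (simp add: k h_def power_mult)
    have "gcong (chi N) d (chi N ^ 1) (chi N ^ (r ^ (j * totient K)))"
      using d(9)[OF cong_sym[OF hK]] unfolding e .
    then have "gcong (chi N) d x (x ^ (r ^ (j * totient K)))"
      using conjunct2[OF i.frobenius_gcong[OF r(1) d(7,3) _ subring_gen.gen that]] by simp
    then show ?thesis unfolding e by (rule gcong_sym)
  qed
  have "X * (Y * w' ^ e) = of_nat r ^ e * of_nat n' * w' ^ e"
    using XY n'(1) by (metis mult.assoc of_nat_mult of_nat_power)
  also have "\<dots> = (d ^ f) ^ e * of_nat n'" unfolding d(8) by (simp only: power_mult_distrib mult_ac)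
  finally have XZ: "X * (Y * w' ^ e) = d ^ (f * e) * of_nat n'" by (simp add: power_mult)
  have "Y * w' ^ e \<in> cyc N" "of_nat n' \<in> cyc N" by (intro subring_gen_intros R d)+
  then obtain a b where ab: "a \<in> cyc N" "b \<in> cyc N" "a * gal N t X = b * X" "gcong (chi N) d a (of_nat n' ^ k)"
    using g.denominator_gcong[OF gal_closed[OF t] d(1,5,6,2) frob period k(1) R(1) _ _ XZ] by metis
  \<comment> \<open>From \<open>d\<close> to \<open>r\<close>: \<open>n' ^ k - a\<close> is a
    multiple of \<open>d\<close>, so its \<open>f\<close>-th power is a multiple of
    \<open>r\<close>, while modulo \<open>a\<close> that power is \<open>n' ^ (k * f)\<close>. Hence
    this integer, prime to \<open>r\<close>, lies in the ideal generated by \<open>r\<close> and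
    \<open>a\<close>, and some multiple of \<open>a\<close> is \<open>1\<close> modulo
    \<open>r\<close>.\<close>
  have "gcong (chi N) a (of_nat n' ^ k - a) (of_nat n' ^ k)"
    unfolding gcong_def by (intro bexI[of _ "-1"] subring_gen_intros) simp
  then have "gcong (chi N) a ((of_nat n' ^ k - a) ^ f) ((of_nat n' ^ k) ^ f)"
    by (intro gcong_power subring_gen_intros ab)
  then obtain g where g: "g \<in> cyc N" "(of_nat n' ^ k - a) ^ f - (of_nat n' ^ k) ^ f = a * g"
    unfolding gcong_def by blast
  obtain y where y: "y \<in> cyc N" "of_nat n' ^ k - a = d * y"
    using gcong_sym[OF ab(4)] unfolding gcong_def by blast
  have "(of_nat n' ^ k - a) ^ f = of_nat r * (w' * y ^ f)"
    unfolding y(2) power_mult_distrib d(8) by (simp only: mult_ac)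
  with g(2) have "of_nat r * (w' * y ^ f) - (of_nat n' ^ k) ^ f = a * g" by simp
  then have eq: "of_nat (n' ^ (k * f)) = of_nat r * (w' * y ^ f) - a * g"
    by (simp only: power_mult of_nat_power) (simp add: diff_eq_eq eq_diff_eq add.commute)
  have "coprime (n' ^ (k * f)) r" using r(1) n'(2) by (metis coprime_commute coprime_power_left_iff prime_imp_coprime)
  then obtain s where "[n' ^ (k * f) * s = 1] (mod r)" using cong_solve_coprime_nat unfolding One_nat_def by blast
  then obtain l l' where l: "1 + l * r = n' ^ (k * f) * s + l' * r" by (metis cong_iff_lin_nat)
  have "(1 :: nat \<Rightarrow> complex) + of_nat l * of_nat r = of_nat (n' ^ (k * f)) * of_nat s + of_nat l' * of_nat r"
    using arg_cong[OF l, of "of_nat :: nat \<Rightarrow> nat \<Rightarrow> complex"] by (simp only: of_nat_add of_nat_mult of_nat_1)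
  then have *: "(of_nat r * (w' * y ^ f) - a * g) * of_nat s + of_nat l' * of_nat r = 1 + of_nat l * of_nat r"
    unfolding eq by (rule sym)
  have "- (of_nat s * g) * a - 1 = ((of_nat r * (w' * y ^ f) - a * g) * of_nat s + of_nat l' * of_nat r)
      - 1 - of_nat l' * of_nat r - of_nat r * (of_nat s * (w' * y ^ f))"
    by (simp add: algebra_simps)
  also have "\<dots> = of_nat r * (of_nat l - of_nat l' - of_nat s * (w' * y ^ f))"
    unfolding * by (simp add: algebra_simps)
  finally have "- (of_nat s * g) * a - 1 = of_nat r * (of_nat l - of_nat l' - of_nat s * (w' * y ^ f))" .
  then have 1: "gcong (chi N) (of_nat r) (- (of_nat s * g) * a) 1"
    unfolding gcong_def using d y
    by (intro bexI[of _ "of_nat l - of_nat l' - of_nat s * (w' * y ^ f)"]) (auto intro!: subring_gen_intros)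
  have "(- (of_nat s * g) * a) * gal N t X = (- (of_nat s * g) * b) * X"
    using ab(3) by (metis mult.assoc)
  moreover have "- (of_nat s * g) * a \<in> cyc N" "- (of_nat s * g) * b \<in> cyc N"
    by (intro subring_gen_intros ab g)+
  ultimately show ?thesis
    unfolding denom_mod_def using 1 by metis
qed

text \<open>Multiplicativity gives a denominator \<open>a\<close> congruent to \<open>1\<close>
  modulo \<open>n\<close>. As \<open>n = X * Y\<close>, both terms of
  \<open>a * gal N t X - (a - 1) * gal N t X\<close> are multiples of \<open>X\<close>.\<close>

lemma gal_quotient_integral:
  assumes N: "N > 0" and t: "coprime t N"
    and R: "X \<in> cyc N" "Y \<in> cyc N" and n: "n > 0" and XY: "X * Y = of_nat n"
    and dec: "\<And>r. prime r \<Longrightarrow> r dvd n \<Longrightarrow>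
      \<exists>a K j. N = r ^ a * K \<and> coprime r K \<and> j \<ge> 1 \<and> [t = r ^ j] (mod K)"
  shows "\<exists>U\<in>cyc N. gal N t X = U * X"
proof -
  have gX: "gal N t X \<in> cyc N" by (rule gal_closed[OF t R(1)])
  have "denom_mod N t X m" if "m dvd n" "m > 0" for m
    using that
  proof (induction m rule: prime_divisors_induct)
    case (unit m)
    have "gcong (chi N) (of_nat m) 0 1"
      unfolding gcong_def using unit by (intro bexI[of _ "-1"] subring_gen_intros) simp
    then show ?case unfolding denom_mod_def
      by (intro bexI[of _ 0] conjI subring_gen_intros) simp_all
  next
    case (factor r m)
    then obtain a K j where "N = r ^ a * K" "coprime r K" "j \<ge> 1" "[t = r ^ j] (mod K)"
      using dec[of r] by (auto dest: dvd_mult_left)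
    then have "denom_mod N t X r" by (intro denom_mod_prime[OF N _ _ _ t _ _ R n XY]) (use factor in auto)
    moreover have "denom_mod N t X m" using factor by (auto dest: dvd_mult_right)
    ultimately show ?case by (rule denom_mod_mult)
  qed simp
  then have "denom_mod N t X n" using n by simp
  then obtain a b where a: "a \<in> cyc N" "b \<in> cyc N" "a * gal N t X = b * X" "gcong (chi N) (of_nat n) a 1"
    unfolding denom_mod_def by blast
  then obtain w where w: "w \<in> cyc N" "a - 1 = of_nat n * w" unfolding gcong_def by blast
  have "gal N t X = a * gal N t X - (a - 1) * gal N t X" by (simp add: algebra_simps)
  also have "\<dots> = (b - Y * w * gal N t X) * X"
    unfolding w a(3) XY[symmetric] by (simp add: algebra_simps)
  finally show ?thesis
    using a w gX R by (intro bexI[of _ "b - Y * w * gal N t X"] subring_gen_intros)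
qed

section \<open>Field descent for exponential sums\<close>

definition expsum :: "nat \<Rightarrow> nat set \<Rightarrow> nat \<Rightarrow> complex" where
  "expsum N S u = (\<Sum>x\<in>S. zeta N ^ (x * u))"

definition chi_sum :: "nat \<Rightarrow> nat set \<Rightarrow> nat \<Rightarrow> complex" where
  "chi_sum N S = (\<Sum>x\<in>S. chi N ^ x)"

lemma sum_fun_apply: "(\<Sum>x\<in>A. f x) u = (\<Sum>x\<in>A. f x u)"
  for f :: "'a \<Rightarrow> 'b \<Rightarrow> 'c::comm_monoid_add"
  by (induction A rule: infinite_finite_induct) (auto simp: plus_fun_apply zero_fun_apply)

lemma chi_sum_apply: "chi_sum N S u = expsum N S (unit_rep N u)"
  by (simp add: chi_sum_def expsum_def sum_fun_apply chi_power_apply)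

lemma chi_sum_closed: "chi_sum N S \<in> cyc N"
  unfolding chi_sum_def by (intro subring_gen_intros)

lemma chi_sum_norm:
  assumes "N > 0"
  shows "(chi_sum N S * gal N (N - 1) (chi_sum N S)) u = of_real (cmod (expsum N S (unit_rep N u)) ^ 2)"
  unfolding times_fun_apply cyc_cnj[OF assms chi_sum_closed, symmetric] chi_sum_apply
  by (metis complex_norm_square of_real_power)

text \<open>The exponents run once through all residues modulo \<open>K\<close>, which leaves the
  orthogonality relation for powers of \<open>\<omega>\<close>.\<close>

lemma sum_root_of_unity_geo_sum:
  fixes \<omega> :: complex
  assumes K: "K > 0" and \<omega>: "\<omega> ^ K = 1"
    and F: "\<And>l. prime l \<Longrightarrow> l dvd K \<Longrightarrow> l dvd F" "even K \<Longrightarrow> 4 dvd F"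
  shows "(\<Sum>k<K. \<omega> ^ geo_sum (1 + F) k) = (if \<omega> = 1 then of_nat K else 0)"
proof -
  have "\<omega> ^ m = \<omega> ^ (m mod K)" for m
  proof -
    have "\<omega> ^ m = \<omega> ^ (K * (m div K) + m mod K)" by simp
    also have "\<dots> = \<omega> ^ (m mod K)" by (simp only: power_add power_mult \<omega>) simp
    finally show ?thesis .
  qed
  then have "(\<Sum>k<K. \<omega> ^ geo_sum (1 + F) k) = (\<Sum>k<K. \<omega> ^ (geo_sum (1 + F) (0 + k) mod K))"
    by (intro sum.cong) auto
  also have "\<dots> = (\<Sum>i<K. \<omega> ^ i)"
    by (rule sum.reindex_bij_betw[OF geo_sum_bij_betw[OF K F]])
  also have "\<dots> = (if \<omega> = 1 then of_nat K else 0)"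
    using \<omega> by (simp add: sum_gp_strict)
  finally show ?thesis .
qed

lemma expsum_norm_le:
  assumes N: "N > 0" and S: "S \<subseteq> {..<N}" and n: "n > 0"
    and norm: "\<And>u. coprime u N \<Longrightarrow> cmod (expsum N S u) ^ 2 = real n"
    and F: "F > 0" "4 dvd F" "\<And>l. prime l \<Longrightarrow> l dvd N \<Longrightarrow> l dvd F"
    and dec: "\<And>r. prime r \<Longrightarrow> r dvd n \<Longrightarrow>
      \<exists>a K j. N = r ^ a * K \<and> coprime r K \<and> j \<ge> 1 \<and> [1 + F = r ^ j] (mod K)"
  shows "n \<le> F ^ 2"
proof -
  have finS: "finite S" using S finite_subset by blast
  define X where "X = chi_sum N S"
  define t where "t = 1 + F"
  have X: "X \<in> cyc N" unfolding X_def by (rule chi_sum_closed)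
  have t: "coprime t N"
  proof (rule coprimeI_by_prime)
    fix l assume l: "prime l" "l dvd N"
    show "\<not> l dvd t"
    proof
      assume "l dvd t"
      then have "l dvd 1" unfolding t_def using F(3)[OF l] dvd_add_left_iff by blast
      then show False using l by simp
    qed
  qed
  have "even F" using F(2) by (metis dvd_trans even_numeral)
  then have t_odd: "odd t" by (simp add: t_def)
  have Y: "gal N (N - 1) X \<in> cyc N" by (rule gal_closed[OF coprime_pred[OF N] X])
  have XY: "X * gal N (N - 1) X = of_nat n"
    by (rule ext) (simp only: X_def chi_sum_norm[OF N] norm[OF coprime_unit_rep] of_nat_fun_apply of_real_of_nat_eq)
  obtain U where U: "U \<in> cyc N" "gal N t X = U * X"
    using gal_quotient_integral[OF N t X Y n XY] dec unfolding t_def by blast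
  have normX: "cmod (X u) ^ 2 = real n" for u
    unfolding X_def chi_sum_apply by (rule norm) simp
  have normU: "cmod (U u) = 1" for u
  proof -
    have "X (t * unit_rep N u) = U u * X u" using fun_cong[OF U(2), of u] by (simp add: gal_def fun_ops)
    then have "real n = cmod (U u) ^ 2 * real n" by (metis normX norm_mult power_mult_distrib)
    then have "cmod (U u) ^ 2 = 1 ^ 2" using n by simp
    then show ?thesis by (metis norm_ge_zero power2_eq_imp_eq zero_le_one)
  qed
  define \<eta> where "\<eta> = U 1"
  have U_eta: "U m = \<eta> ^ m" if "odd m" "coprime m N" for m
    using fun_cong[OF cyc_unimodular_gal[OF N U(1) normU that], of 1]
    by (simp add: gal_def fun_ops \<eta>_def)
  have \<eta>0: "\<eta> \<noteq> 0" using normU[of 1] by (auto simp: \<eta>_def)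
  \<comment> \<open>\<open>1 + 2 * N\<close> is odd and congruent to \<open>1\<close> modulo
    \<open>N\<close>, so \<open>U\<close> takes the value \<open>\<eta>\<close> there, which is also
    \<open>\<eta> ^ (1 + 2 * N)\<close>.\<close>
  have \<eta>: "\<eta> ^ (2 * N) = 1"
  proof -
    have cop: "coprime (1 + 2 * N) N"
    proof (rule coprimeI)
      fix m assume m: "m dvd 1 + 2 * N" "m dvd N"
      then have "m dvd 2 * N" by simp
      then show "is_unit m" using m(1) by (simp only: dvd_add_left_iff)
    qed
    have "[1 + 2 * N = 1] (mod N)" by (simp only: cong_def mod_mult_self1)
    then have "U (1 + 2 * N) = U 1" using cop by (intro cyc_cong[OF N U(1)]) simp
    then have "\<eta> ^ (1 + 2 * N) = \<eta> ^ 1" using U_eta[of "1 + 2 * N"] cop by (simp add: \<eta>_def)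
    then have "\<eta> * \<eta> ^ (2 * N) = \<eta> * 1" by simp
    then show ?thesis using \<eta>0 by (metis mult_left_cancel)
  qed
  have tk: "coprime (t ^ k) N" "odd (t ^ k)" for k using t t_odd by auto
  \<comment> \<open>Iterating \<open>gal N t X = U * X\<close> multiplies the values
    \<open>U (t ^ i) = \<eta> ^ (t ^ i)\<close>, whose exponents add up to a geometric sum.\<close>
  have X_orbit: "X (t ^ k) = \<eta> ^ geo_sum t k * X 1" for k
  proof (induction k)
    case 0
    show ?case by (simp add: geo_sum_def)
  next
    case (Suc k)
    have "X (t ^ Suc k) = U (t ^ k) * X (t ^ k)"
      using fun_cong[OF U(2), of "t ^ k"] tk by (simp add: gal_def fun_ops)
    then show ?case using Suc U_eta[OF tk(2,1)] by (simp add: geo_sum_Suc power_add)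
  qed
  have K: "2 * N > 0" and KF: "\<And>l. prime l \<Longrightarrow> l dvd 2 * N \<Longrightarrow> l dvd F" "even (2 * N) \<Longrightarrow> 4 dvd F"
    using N F \<open>even F\<close> by (auto simp: prime_dvd_mult_iff primes_dvd_imp_eq)
  \<comment> \<open>As \<open>t ^ k = 1 + F * geo_sum t k\<close>, the \<open>k\<close>-th conjugate
    corrected by the power of \<open>\<eta>\<close> multiplies the term of \<open>x\<close> by
    \<open>\<omega> x ^ geo_sum t k\<close>. Averaging over \<open>k < 2 * N\<close> retains only
    the \<open>x\<close> with \<open>\<omega> x = 1\<close>.\<close>
  define \<omega> where "\<omega> x = zeta N ^ (x * F) * inverse \<eta>" for x
  have \<omega>N: "\<omega> x ^ (2 * N) = 1" for x
  proof -
    have "(zeta N ^ (x * F)) ^ (2 * N) = 1"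
      unfolding power_mult[symmetric] zeta_power_eq_1_iff[OF N] by simp
    then show ?thesis using \<eta> by (simp only: \<omega>_def power_mult_distrib power_inverse) simp
  qed
  have "of_nat (2 * N) * X 1 = (\<Sum>k<2 * N. inverse \<eta> ^ geo_sum t k * X (t ^ k))"
  proof -
    have "inverse \<eta> ^ geo_sum t k * X (t ^ k) = X 1" for k
      unfolding X_orbit power_inverse using \<eta>0 by simp
    then show ?thesis by simp
  qed
  also have "\<dots> = (\<Sum>k<2 * N. \<Sum>x\<in>S. zeta N ^ x * \<omega> x ^ geo_sum t k)"
  proof (rule sum.cong[OF refl])
    fix k
    have "zeta N ^ (x * t ^ k) = zeta N ^ x * (zeta N ^ (x * F)) ^ geo_sum t k" for x
      unfolding t_def power_eq_geo_sum by (simp add: power_add power_mult[symmetric] algebra_simps)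
    then have "X (t ^ k) = (\<Sum>x\<in>S. zeta N ^ x * (zeta N ^ (x * F)) ^ geo_sum t k)"
      using tk(1) by (simp add: X_def chi_sum_apply expsum_def)
    then show "inverse \<eta> ^ geo_sum t k * X (t ^ k) = (\<Sum>x\<in>S. zeta N ^ x * \<omega> x ^ geo_sum t k)"
      by (simp add: sum_distrib_left \<omega>_def power_mult_distrib mult_ac)
  qed
  also have "\<dots> = (\<Sum>x\<in>S. zeta N ^ x * (\<Sum>k<2 * N. \<omega> x ^ geo_sum t k))"
    by (subst sum.swap) (simp add: sum_distrib_left)
  also have "\<dots> = (\<Sum>x\<in>S. zeta N ^ x * (if \<omega> x = 1 then of_nat (2 * N) else 0))"
    unfolding t_def using sum_root_of_unity_geo_sum[OF K \<omega>N KF] by simp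
  also have "\<dots> = (\<Sum>x\<in>S. of_nat (2 * N) * (if \<omega> x = 1 then zeta N ^ x else 0))"
    by (rule sum.cong) auto
  also have "\<dots> = of_nat (2 * N) * (\<Sum>x\<in>{x\<in>S. \<omega> x = 1}. zeta N ^ x)"
    by (simp add: sum_distrib_left[symmetric] sum.inter_filter[OF finS])
  finally have "X 1 = (\<Sum>x\<in>{x\<in>S. \<omega> x = 1}. zeta N ^ x)"
    using K by (metis mult_left_cancel of_nat_eq_0_iff neq0_conv)
  then have "cmod (X 1) \<le> (\<Sum>x\<in>{x\<in>S. \<omega> x = 1}. cmod (zeta N ^ x))"
    using norm_sum by metis
  then have le: "cmod (X 1) \<le> real (card {x\<in>S. \<omega> x = 1})" by simp
  \<comment> \<open>A surviving term is a solution \<open>z\<close> of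
    \<open>z ^ F = \<eta>\<close>.\<close>
  have "card {x\<in>S. \<omega> x = 1} \<le> card {z. z ^ F = \<eta>}"
  proof (rule card_inj_on_le)
    show "inj_on (\<lambda>x. zeta N ^ x) {x\<in>S. \<omega> x = 1}"
    proof (rule inj_onI)
      fix x y assume xy: "x \<in> {x\<in>S. \<omega> x = 1}" "y \<in> {x\<in>S. \<omega> x = 1}" "zeta N ^ x = zeta N ^ y"
      then have "[x = y] (mod N)" "x < N" "y < N" using zeta_power_eq_iff[OF N] S by auto
      then show "x = y" by (rule cong_less_modulus_unique_nat)
    qed
    show "(\<lambda>x. zeta N ^ x) ` {x\<in>S. \<omega> x = 1} \<subseteq> {z. z ^ F = \<eta>}"
      using \<eta>0 by (auto simp: \<omega>_def power_mult[symmetric] field_simps)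
    show "finite {z. z ^ F = \<eta>}" using \<eta>0 F(1) by (intro finite_nth_roots) auto
  qed
  also have "\<dots> = F" using \<eta>0 F(1) by (intro card_nth_roots) auto
  finally have "cmod (X 1) \<le> real F" using le by linarith
  then have "cmod (X 1) ^ 2 \<le> real F ^ 2" by (intro power_mono) auto
  then show ?thesis unfolding normX by (metis of_nat_le_iff of_nat_power)
qed

section \<open>Integrality and conjugation invariance\<close>

text \<open>A linear extension from the line through \<open>1\<close> in the rational vector space
  of complex numbers; it detects denominators without a basis of the cyclotomic field.\<close>

lemma rat_linear_functional:
  "\<exists>g::complex \<Rightarrow> rat. (\<forall>x y. g (x - y) = g x - g y) \<and> (\<forall>q. g (of_rat q) = q)"
proof -
  interpret vector_space_pair "\<lambda>q (z::complex). of_rat q * z" "(*) :: rat \<Rightarrow> rat \<Rightarrow> rat"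
    by unfold_locales (auto simp: algebra_simps of_rat_add of_rat_mult)
  have "vs1.independent {1}" by (rule vs1.independent_insertI) (auto simp: vs1.independent_empty)
  then obtain g where g: "Vector_Spaces.linear (\<lambda>q (z::complex). of_rat q * z) ((*) :: rat \<Rightarrow> rat \<Rightarrow> rat) g" "g 1 = 1"
    using linear_independent_extend[of "{1}" "\<lambda>_. 1"] by auto
  have "g (of_rat q) = q" for q
    using linear_scale[OF g(1), of q 1] g(2) by simp
  then show ?thesis using linear_diff[OF g(1)] by blast
qed

lemma rat_integer_if_bounded_denominator:
  fixes c :: rat
  assumes M: "M > 0" and "\<And>k. of_nat M * c ^ k \<in> \<int>"
  shows "c \<in> \<int>"
proof -
  obtain a b where ab: "quotient_of c = (a, b)" by fastforce
  have b: "b > 0" and cop: "coprime a b" and c: "c = of_int a / of_int b"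
    using quotient_of_denom_pos[OF ab] quotient_of_coprime[OF ab] quotient_of_div[OF ab] by auto
  have "b ^ k dvd int M" for k
  proof -
    obtain z where z: "of_nat M * c ^ k = of_int z" using assms(2) by (auto elim: Ints_cases)
    then have "(of_int (int M * a ^ k) :: rat) = of_int (z * b ^ k)"
      using b unfolding c by (simp add: field_simps)
    then have "int M * a ^ k = z * b ^ k" by (simp only: of_int_eq_iff)
    then have "b ^ k dvd int M * a ^ k" by simp
    moreover have "coprime (b ^ k) (a ^ k)" using cop by (simp add: coprime_commute)
    ultimately show ?thesis by (simp add: coprime_dvd_mult_left_iff)
  qed
  \<comment> \<open>The exponent \<open>M\<close> suffices: a denominator of at least
    \<open>2\<close> would give \<open>2 ^ M \<le> M\<close>.\<close>
  then have le: "b ^ M \<le> int M" using M by (intro zdvd_imp_le) auto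
  have "b = 1"
  proof (rule ccontr)
    assume "b \<noteq> 1"
    then have "2 ^ M \<le> b ^ M" using b by (intro power_mono) auto
    moreover have "int M < 2 ^ M" using less_exp[of M] by (metis of_nat_less_iff of_nat_numeral of_nat_power)
    ultimately show False using le by linarith
  qed
  then show ?thesis using c by simp
qed

text \<open>The functional takes finitely many values at powers of \<open>zeta N\<close>, so one
  \<open>M\<close> clears its denominators on the whole ring. Applied to the powers of
  \<open>G\<close>, it bounds the denominators of all \<open>c ^ k\<close>.\<close>

lemma cyc_rational_integer:
  assumes N: "N > 0" and G: "G \<in> cyc N" and c: "G u = of_rat c"
  shows "c \<in> \<int>"
proof -
  obtain g :: "complex \<Rightarrow> rat" where g: "\<And>x y. g (x - y) = g x - g y" "\<And>q. g (of_rat q) = q"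
    using rat_linear_functional by blast
  define den where "den j = snd (quotient_of (g (zeta N ^ j)))" for j
  have den: "den j > 0" "of_int (den j) * g (zeta N ^ j) \<in> \<int>" for j
  proof -
    obtain a b where ab: "quotient_of (g (zeta N ^ j)) = (a, b)" by fastforce
    then show "den j > 0" "of_int (den j) * g (zeta N ^ j) \<in> \<int>"
      using quotient_of_denom_pos[OF ab] quotient_of_div[OF ab] by (auto simp: den_def)
  qed
  define M where "M = nat (\<Prod>j<N. den j)"
  have Mpos: "(\<Prod>j<N. den j) > 0" by (rule prod_pos) (use den in auto)
  then have M: "M > 0" "int M = (\<Prod>j<N. den j)" by (auto simp: M_def)
  have M_int: "of_nat M * g (zeta N ^ j) \<in> \<int>" for j
  proof -
    have "den (j mod N) dvd (\<Prod>j<N. den j)" using N by (intro dvd_prodI) auto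
    then obtain e where "int M = den (j mod N) * e" unfolding M(2) by blast
    then have "(of_int (int M) :: rat) = of_int (den (j mod N)) * of_int e" by (metis of_int_mult)
    then have "of_nat M * g (zeta N ^ j) = of_int e * (of_int (den (j mod N)) * g (zeta N ^ (j mod N)))"
      using N by (simp add: zeta_power_mod)
    also have "\<dots> \<in> \<int>" by (intro Ints_mult[OF Ints_of_int] den(2))
    finally show ?thesis .
  qed
  have "of_nat M * c ^ k \<in> \<int>" for k
  proof -
    have "of_nat M * g ((G ^ k) u) \<in> \<int>"
    proof (rule subring_gen_additive[OF _ subring_gen_power[OF G], where L = "\<lambda>H. of_nat M * g (H u)"])
      show "of_nat M * g ((chi N ^ j) u) \<in> \<int>" for j
        unfolding chi_power_apply by (rule M_int)
    qed (auto simp: g(1) minus_apply right_diff_distrib)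
    then show ?thesis by (simp add: power_fun_apply c of_rat_power[symmetric] g(2))
  qed
  then show ?thesis by (rule rat_integer_if_bounded_denominator[OF M(1)])
qed

lemma fermat_nat: "prime r \<Longrightarrow> [a ^ r = a] (mod r)" for a r :: nat
proof (cases "r dvd a")
  case True
  assume "prime r"
  then have "r dvd a ^ r" using True prime_gt_0_nat dvd_power[of r a] by (meson dvd_trans)
  then show ?thesis using True by (simp add: cong_def mod_eq_0_iff_dvd)
next
  case False
  assume "prime r"
  then have "[a * a ^ (r - 1) = a * 1] (mod r)"
    using False by (intro cong_scalar_left fermat_theorem)
  moreover have "a * a ^ (r - 1) = a ^ r" using prime_gt_0_nat[OF \<open>prime r\<close>] by (metis power_minus_mult mult.commute)
  ultimately show ?thesis by simp
qed

text \<open>Add to \<open>u\<close> the product of \<open>N\<close> and the primes up to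
  \<open>B\<close> not dividing \<open>u\<close>: each prime up to \<open>B\<close> then divides
  exactly one of the two summands. This is an elementary stand-in for Dirichlet's theorem.\<close>

lemma exists_rep_large_prime_factors:
  fixes u N B :: nat
  assumes "N > 0" "coprime u N"
  obtains u' where "[u' = u] (mod N)" "u' > 0" "\<And>l. prime l \<Longrightarrow> l dvd u' \<Longrightarrow> l > B"
proof -
  define P where "P = \<Prod>{l. prime l \<and> l \<le> B \<and> \<not> l dvd u}"
  have fin: "finite {l. prime l \<and> l \<le> B \<and> \<not> l dvd u}" by (rule finite_subset[of _ "{..B}"]) auto
  have "P > 0" unfolding P_def by (rule prod_pos) (auto intro: prime_gt_0_nat)
  have large: "l > B" if l: "prime l" "l dvd u + N * P" for l
  proof (rule ccontr)
    assume "\<not> l > B"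
    then have lB: "l \<le> B" by simp
    show False
    proof (cases "l dvd u")
      case True
      then have "l dvd N * P" using l(2) by (simp add: dvd_add_right_iff)
      moreover have "\<not> l dvd N" using True assms(2) l(1) by (metis coprime_common_divisor not_prime_unit)
      ultimately have "l dvd P" using l(1) by (simp add: prime_dvd_mult_iff)
      then obtain l' where "l' \<in> {l. prime l \<and> l \<le> B \<and> \<not> l dvd u}" "l dvd l'"
        unfolding P_def using l(1) fin by (auto simp: prime_dvd_prod_iff)
      then show False using True l(1) primes_dvd_imp_eq by auto
    next
      case False
      then have "l dvd P" unfolding P_def using fin l(1) lB by (intro dvd_prodI) auto
      then have "l dvd u" using l(2) by (simp add: dvd_add_left_iff)
      then show False using False by simp
    qed
  qed
  show ?thesis
  proof (rule that[of "u + N * P"])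
    show "[u + N * P = u] (mod N)" by (simp add: cong_def)
    show "u + N * P > 0" using assms(1) \<open>P > 0\<close> by simp
  qed (rule large)
qed

text \<open>The rational values are integers between \<open>0\<close> and \<open>N ^ 2\<close>. For
  a prime \<open>r > N ^ 2\<close> not dividing \<open>N\<close>,
  \<open>W (r * u) \<equiv> W u ^ r \<equiv> W u\<close> modulo \<open>r\<close> forces equality,
  and every unit class has a representative composed of such primes.\<close>

lemma expsum_norm_const:
  assumes N: "N > 0" and S: "S \<subseteq> {..<N}"
    and rat: "\<And>u. coprime u N \<Longrightarrow> cmod (expsum N S u) ^ 2 \<in> \<rat>"
  shows "\<exists>n::nat. \<forall>u. coprime u N \<longrightarrow> cmod (expsum N S u) ^ 2 = real n"
proof -
  define W where "W = chi_sum N S * gal N (N - 1) (chi_sum N S)"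
  have W: "W \<in> cyc N" unfolding W_def
    by (intro subring_gen_intros chi_sum_closed gal_closed coprime_pred N)
  have Wu: "W u = of_real (cmod (expsum N S (unit_rep N u)) ^ 2)" for u
    unfolding W_def by (rule chi_sum_norm[OF N])
  define B where "B = N ^ 2"
  have bound: "cmod (expsum N S u) ^ 2 \<le> real B" for u
  proof -
    have "card S \<le> N" using S card_mono[of "{..<N}" S] by simp
    have "cmod (expsum N S u) \<le> (\<Sum>x\<in>S. cmod (zeta N ^ (x * u)))"
      unfolding expsum_def by (rule norm_sum)
    also have "\<dots> \<le> real N" using \<open>card S \<le> N\<close> by simp
    finally have "cmod (expsum N S u) ^ 2 \<le> real N ^ 2" by (intro power_mono) auto
    then show ?thesis by (simp add: B_def)
  qed
  have W_nat: "\<exists>a\<le>B. W u = of_nat a" for u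
  proof -
    obtain c where c: "cmod (expsum N S (unit_rep N u)) ^ 2 = of_rat c"
      using rat[OF coprime_unit_rep[of N u]] by (auto elim: Rats_cases)
    moreover have "complex_of_real (of_rat c) = of_rat c" by (cases c) (simp add: of_rat_rat)
    ultimately have "W u = of_rat c" unfolding Wu by simp
    then have "c \<in> \<int>" by (rule cyc_rational_integer[OF N W])
    then obtain z where "c = of_int z" by (auto elim: Ints_cases)
    then have z: "cmod (expsum N S (unit_rep N u)) ^ 2 = of_int z" using c by simp
    then have "z \<ge> 0" "z \<le> int B"
      using bound[of "unit_rep N u"] by (metis of_int_0_le_iff zero_le_power2, metis of_int_le_iff of_int_of_nat_eq)
    then show ?thesis using z unfolding Wu by (intro exI[of _ "nat z"]) auto
  qed
  have W_prime: "W (r * u) = W u" if r: "prime r" "r > B" "coprime r N" and u: "coprime u N" for r u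
  proof -
    interpret ring_hom_fun "gal N r" by (rule ring_hom_gal)
    have "gcong (chi N) (of_nat r) (gal N r W) (W ^ (r ^ 1))"
      by (rule conjunct2[OF frobenius_gcong[OF r(1), where w = 1]])
        (use r W in \<open>auto simp: gal_chi gcong_refl intro: subring_gen_intros\<close>)
    then obtain z where z: "z \<in> cyc N" "gal N r W - W ^ r = of_nat r * z"
      unfolding gcong_def by auto
    obtain a where a: "W u = of_nat a" "a \<le> B" using W_nat by blast
    obtain b where b: "W (r * u) = of_nat b" "b \<le> B" using W_nat by blast
    have "of_nat b - of_nat a ^ r = of_nat r * z u"
      using fun_cong[OF z(2), of u] a b u by (simp add: gal_def fun_ops)
    \<comment> \<open>The congruence in the ring becomes one between integers, since a rational
      value of \<open>z\<close> is an integer.\<close>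
    then have zu: "z u = of_rat ((of_nat b - of_nat a ^ r) / of_nat r)"
      using prime_gt_0_nat[OF r(1)]
      by (simp add: of_rat_divide of_rat_diff of_rat_power field_simps)
    have "(of_nat b - of_nat a ^ r) / of_nat r \<in> (\<int> :: rat set)"
      by (rule cyc_rational_integer[OF N z(1) zu])
    then obtain y where "(of_nat b - of_nat a ^ r) / of_nat r = (of_int y :: rat)" by (auto elim: Ints_cases)
    then have "(of_int (int b - int a ^ r) :: rat) = of_int (y * int r)"
      using prime_gt_0_nat[OF r(1)] by (simp add: field_simps)
    then have "int b - int a ^ r = y * int r" by (simp only: of_int_eq_iff)
    then have "[int b = int (a ^ r)] (mod int r)" by (simp add: cong_iff_dvd_diff)
    then have "[b = a ^ r] (mod r)" by (simp only: cong_int_iff)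
    then have "[b = a] (mod r)" using fermat_nat[OF r(1)] cong_trans by blast
    then have "b = a" using a b r(2) by (intro cong_less_modulus_unique_nat[of b a r]) auto
    then show ?thesis using a b by simp
  qed
  have W_mult: "W (m * u) = W u"
    if "\<And>l. prime l \<Longrightarrow> l dvd m \<Longrightarrow> l > B" "coprime m N" "m > 0" "coprime u N" for m u
    using that
  proof (induction m arbitrary: u rule: prime_divisors_induct)
    case (factor r m)
    have "W (r * (m * u)) = W (m * u)"
      using factor by (intro W_prime) auto
    moreover have "W (m * u) = W u" using factor by (intro factor.IH) auto
    ultimately show ?case by (simp add: mult.assoc)
  qed auto
  obtain n where n: "W 1 = of_nat n" using W_nat by blast
  have "cmod (expsum N S u) ^ 2 = real n" if u: "coprime u N" for u
  proof -
    obtain u' where u': "[u' = u] (mod N)" "u' > 0" "\<And>l. prime l \<Longrightarrow> l dvd u' \<Longrightarrow> l > B"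
      using exists_rep_large_prime_factors[OF N u] by metis
    have cop: "coprime u' N" using u u'(1) by (metis cong_imp_coprime cong_sym)
    have "W u = W u'" using u u' cop by (intro cyc_cong[OF N W]) (auto intro: cong_sym)
    also have "\<dots> = W 1" using W_mult[OF u'(3) cop u'(2), of 1] by simp
    finally have "W u = of_nat n" using n by simp
    then have "complex_of_real (cmod (expsum N S u) ^ 2) = of_real (real n)"
      unfolding Wu using u by simp
    then show ?thesis by (simp only: of_real_eq_iff)
  qed
  then show ?thesis by blast
qed

section \<open>Formal duality\<close>

definition char_sum :: "nat \<Rightarrow> int set \<Rightarrow> int \<Rightarrow> complex" where
  "char_sum N S y = (\<Sum>x\<in>S. zeta N powi (x * y))"

lemma zeta_powi_eq_1_iff: "N > 0 \<Longrightarrow> zeta N powi k = 1 \<longleftrightarrow> int N dvd k"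
  by (cases k rule: int_cases2)
    (auto simp: power_int_minus zeta_power_eq_1_iff simp del: of_nat_Suc)

lemma zeta_powi_mod: "N > 0 \<Longrightarrow> zeta N powi (k mod int N) = zeta N powi k"
proof -
  assume N: "N > 0"
  have "zeta N powi k = zeta N powi (int N * (k div int N) + k mod int N)" by simp
  also have "\<dots> = zeta N powi (int N * (k div int N)) * zeta N powi (k mod int N)"
    by (rule power_int_add) simp
  also have "zeta N powi (int N * (k div int N)) = 1" by (simp only: zeta_powi_eq_1_iff[OF N] dvd_triv_left)
  finally show ?thesis by simp
qed

lemma zeta_powi_cong:
  assumes "N > 0" "j mod int N = k mod int N"
  shows "zeta N powi j = zeta N powi k"
  using zeta_powi_mod[OF assms(1), of j] zeta_powi_mod[OF assms(1), of k] assms(2) by simp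

lemma cnj_zeta_powi: "cnj (zeta N powi k) = zeta N powi (- k)"
proof -
  have "cmod (zeta N) = 1" using cmod_zeta_power[of N 1] by simp
  then have "cnj (zeta N) = inverse (zeta N)"
    by (metis complex_cnj_cnj complex_norm_square inverse_unique mult.commute of_real_1 power_one)
  then have "cnj (zeta N powi k) = inverse (zeta N) powi k" by (simp add: power_int_def)
  then show ?thesis by (simp add: power_int_minus power_int_inverse)
qed

lemma sum_zeta_powi:
  assumes N: "N > 0"
  shows "(\<Sum>y\<in>{0..<int N}. zeta N powi (k * y)) = (if int N dvd k then of_nat N else 0)"
proof -
  have "(\<Sum>y\<in>{0..<int N}. zeta N powi (k * y)) = (\<Sum>i<N. (zeta N powi k) ^ i)"
    by (rule sum.reindex_bij_witness[of _ int nat]) (auto simp: power_int_mult power_int_def[of "zeta N powi k"])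
  moreover have "(zeta N powi k) ^ N = 1"
  proof -
    have "(zeta N powi k) ^ N = zeta N powi (k * int N)" by (simp add: power_int_mult)
    also have "\<dots> = 1" by (simp only: zeta_powi_eq_1_iff[OF N] dvd_triv_right)
    finally show ?thesis .
  qed
  ultimately show ?thesis
    using zeta_powi_eq_1_iff[OF N, of k] by (simp add: sum_gp_strict)
qed

lemma norm_char_sum:
  "of_real (cmod (char_sum N S y) ^ 2) = (\<Sum>x\<in>S. \<Sum>x'\<in>S. zeta N powi ((x - x') * y))"
proof -
  have "of_real (cmod (char_sum N S y) ^ 2) = char_sum N S y * cnj (char_sum N S y)"
    by (metis complex_norm_square of_real_power)
  also have "\<dots> = (\<Sum>x\<in>S. \<Sum>x'\<in>S. zeta N powi (x * y) * zeta N powi (- (x' * y)))"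
    by (simp add: char_sum_def cnj_sum cnj_zeta_powi sum_product del: complex_cnj_power_int)
  also have "\<dots> = (\<Sum>x\<in>S. \<Sum>x'\<in>S. zeta N powi ((x - x') * y))"
    by (intro sum.cong refl) (simp add: power_int_add[symmetric] left_diff_distrib)
  finally show ?thesis .
qed

lemma sum_nu:
  fixes g :: "int \<Rightarrow> 'a::comm_semiring_1"
  assumes N: "N > 0" and T: "finite T" and g: "\<And>k. g (k mod int N) = g k"
  shows "(\<Sum>y\<in>{0..<int N}. of_nat (nu N T y) * g y) = (\<Sum>t\<in>T. \<Sum>t'\<in>T. g (t - t'))"
proof -
  let ?h = "\<lambda>p::int \<times> int. (fst p - snd p) mod int N"
  have "(\<Sum>t\<in>T. \<Sum>t'\<in>T. g (t - t')) = (\<Sum>p\<in>T \<times> T. g (?h p))"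
    by (simp add: sum.cartesian_product case_prod_unfold g)
  also have "\<dots> = (\<Sum>y\<in>{0..<int N}. \<Sum>p\<in>{p\<in>T \<times> T. ?h p = y}. g (?h p))"
    by (rule sum.group[symmetric]) (use N T in auto)
  also have "\<dots> = (\<Sum>y\<in>{0..<int N}. of_nat (nu N T y) * g y)"
  proof (rule sum.cong[OF refl])
    fix y
    have "{p\<in>T \<times> T. ?h p = y} = {(t, t'). t \<in> T \<and> t' \<in> T \<and> (t - t') mod int N = y}" by auto
    then have "(\<Sum>p\<in>{p\<in>T \<times> T. ?h p = y}. g y) = of_nat (nu N T y) * g y"
      by (simp add: nu_def)
    moreover have "(\<Sum>p\<in>{p\<in>T \<times> T. ?h p = y}. g (?h p)) = (\<Sum>p\<in>{p\<in>T \<times> T. ?h p = y}. g y)"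
      by (rule sum.cong) auto
    ultimately show "(\<Sum>p\<in>{p\<in>T \<times> T. ?h p = y}. g (?h p)) = of_nat (nu N T y) * g y"
      by simp
  qed
  finally show ?thesis by simp
qed

text \<open>Fourier inversion: the squared modulus of \<open>char_sum\<close> is the transform of
  \<open>nu\<close>.\<close>

lemma sum_norm_char_sum:
  assumes N: "N > 0" and S: "finite S" and z: "z \<in> {0..<int N}"
  shows "(\<Sum>y\<in>{0..<int N}. of_real (cmod (char_sum N S y) ^ 2) * zeta N powi (- (z * y))) =
    of_nat N * of_nat (nu N S z)"
proof -
  have "(\<Sum>y\<in>{0..<int N}. of_real (cmod (char_sum N S y) ^ 2) * zeta N powi (- (z * y))) =
     (\<Sum>y\<in>{0..<int N}. \<Sum>x\<in>S. \<Sum>x'\<in>S. zeta N powi ((x - x' - z) * y))"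
    unfolding norm_char_sum sum_distrib_right
    by (intro sum.cong refl) (simp add: power_int_add[symmetric] left_diff_distrib)
  also have "\<dots> = (\<Sum>x\<in>S. \<Sum>y\<in>{0..<int N}. \<Sum>x'\<in>S. zeta N powi ((x - x' - z) * y))"
    by (rule sum.swap)
  also have "\<dots> = (\<Sum>x\<in>S. \<Sum>x'\<in>S. \<Sum>y\<in>{0..<int N}. zeta N powi ((x - x' - z) * y))"
    by (intro sum.cong refl sum.swap)
  also have "\<dots> = (\<Sum>x\<in>S. \<Sum>x'\<in>S. if (x - x') mod int N = z then of_nat N else 0)"
  proof -
    have "int N dvd x - x' - z \<longleftrightarrow> (x - x') mod int N = z" for x x'
      using z by (simp add: mod_eq_dvd_iff[symmetric])
    then show ?thesis unfolding sum_zeta_powi[OF N] by simp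
  qed
  also have "\<dots> = (\<Sum>y\<in>{0..<int N}. of_nat (nu N S y) * (if y mod int N = z then of_nat N else 0))"
    by (rule sum_nu[OF N S, symmetric]) simp
  also have "\<dots> = (\<Sum>y\<in>{0..<int N}. if y = z then of_nat N * of_nat (nu N S z) else 0)"
    by (rule sum.cong) auto
  also have "\<dots> = of_nat N * of_nat (nu N S z)" using z by simp
  finally show ?thesis .
qed

locale formal_dual_pair =
  fixes N :: nat and S T :: "int set"
  assumes N: "N > 0" and dual: "formally_dual N S T"
begin

lemma subsets: "S \<subseteq> {0..<int N}" "T \<subseteq> {0..<int N}" "S \<noteq> {}" "T \<noteq> {}"
  using dual N by (auto simp: formally_dual_def carrier_integer_mod_group)

lemma finite_sets: "finite S" "finite T"
  using subsets finite_subset by blast+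

lemma card_pos: "card S > 0" "card T > 0"
  using finite_sets subsets card_gt_0_iff by blast+

lemma norm_char_sum_eq:
  assumes "y \<in> {0..<int N}"
  shows "cmod (char_sum N S y) ^ 2 * real (card T) = real (card S) ^ 2 * real (nu N T y)"
proof -
  have "1 / real (card S) ^ 2 * (cmod (char_sum N S y)) ^ 2 = 1 / real (card T) * real (nu N T y)"
    using dual assms N by (simp add: formally_dual_def char_sum_def carrier_integer_mod_group)
  then show ?thesis using card_pos by (simp add: field_simps)
qed

text \<open>The Fourier transform of the duality identity. It is the identity with \<open>S\<close>
  and \<open>T\<close> exchanged up to a constant, which its value at \<open>0\<close> determines
  through \<open>card S * card T = N\<close>.\<close>

lemma char_sum_nu:
  assumes "z \<in> {0..<int N}"
  shows "real (card S) ^ 2 * cmod (char_sum N T z) ^ 2 = real N * real (card T) * real (nu N S z)"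
proof -
  have "complex_of_real (real (card T) * (real N * real (nu N S z))) =
      of_nat (card T) * (\<Sum>y\<in>{0..<int N}. of_real (cmod (char_sum N S y) ^ 2) * zeta N powi (- (z * y)))"
    unfolding sum_norm_char_sum[OF N finite_sets(1) assms] by simp
  also have "\<dots> = (\<Sum>y\<in>{0..<int N}. of_real (cmod (char_sum N S y) ^ 2 * real (card T)) * zeta N powi (- (z * y)))"
    by (simp add: sum_distrib_left mult_ac)
  also have "\<dots> = (\<Sum>y\<in>{0..<int N}. of_real (real (card S) ^ 2 * real (nu N T y)) * zeta N powi (- (z * y)))"
    by (intro sum.cong refl) (simp only: norm_char_sum_eq)
  also have "\<dots> = of_nat (card S) ^ 2 * (\<Sum>y\<in>{0..<int N}. of_nat (nu N T y) * zeta N powi (- (z * y)))"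
    by (simp add: sum_distrib_left mult_ac)
  also have "(\<Sum>y\<in>{0..<int N}. of_nat (nu N T y) * zeta N powi (- (z * y))) =
      (\<Sum>t\<in>T. \<Sum>t'\<in>T. zeta N powi (- (z * (t - t'))))"
    by (intro sum_nu[OF N finite_sets(2)] zeta_powi_cong[OF N])
      (metis mod_minus_cong mod_mult_right_eq)
  also have "\<dots> = (\<Sum>t'\<in>T. \<Sum>t\<in>T. zeta N powi ((t' - t) * z))"
    by (subst sum.swap) (simp add: algebra_simps)
  also have "\<dots> = of_real (cmod (char_sum N T z) ^ 2)" by (rule norm_char_sum[symmetric])
  also have "of_nat (card S) ^ 2 * complex_of_real (cmod (char_sum N T z) ^ 2) =
      of_real (real (card S) ^ 2 * cmod (char_sum N T z) ^ 2)" by simp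
  finally show ?thesis by (simp only: of_real_eq_iff mult_ac)
qed

lemma nu_zero: "nu N S 0 = card S"
proof -
  have "{(t, t'). t \<in> S \<and> t' \<in> S \<and> (t - t') mod int N = 0} = (\<lambda>t. (t, t)) ` S"
  proof -
    have "t = t'" if t: "t \<in> S" "t' \<in> S" "int N dvd t - t'" for t t'
    proof -
      have "t mod int N = t' mod int N" using t(3) by (simp add: mod_eq_dvd_iff)
      moreover have "t mod int N = t" "t' mod int N = t'" using subsetD[OF subsets(1)] t by auto
      ultimately show ?thesis by simp
    qed
    then show ?thesis by (auto simp: mod_eq_0_iff_dvd)
  qed
  then show ?thesis by (simp add: nu_def card_image inj_on_def)
qed

lemma card_mult: "card S * card T = N"
proof -
  have "real (card S) ^ 2 * real (card T) ^ 2 = real N * real (card T) * real (card S)"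
    using char_sum_nu[of 0] N by (simp add: char_sum_def nu_zero)
  then have "real (card S) * real (card T) = real N"
    using card_pos by (simp add: power2_eq_square)
  then show ?thesis by (metis of_nat_eq_iff of_nat_mult)
qed

lemma dual_sym: "formally_dual N T S"
proof -
  have "1 / real (card T) ^ 2 * cmod (char_sum N T y) ^ 2 = 1 / real (card S) * real (nu N S y)"
    if "y \<in> {0..<int N}" for y
  proof -
    have "real (card S) ^ 2 * cmod (char_sum N T y) ^ 2 =
        real (card S) * real (card T) * real (card T) * real (nu N S y)"
      using char_sum_nu[OF that] card_mult by (metis of_nat_mult)
    then have "real (card S) * cmod (char_sum N T y) ^ 2 = real (card T) ^ 2 * real (nu N S y)"
      using card_pos by (simp add: power2_eq_square)
    then show ?thesis using card_pos by (simp add: field_simps)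
  qed
  then show ?thesis
    using N subsets by (simp add: formally_dual_def char_sum_def carrier_integer_mod_group)
qed

lemma expsum_eq_char_sum: "expsum N (nat ` S) u = char_sum N S (int u mod int N)"
proof -
  have inj: "inj_on nat S" using subsetD[OF subsets(1)] by (intro inj_onI) (simp add: nat_eq_iff2)
  show ?thesis
    unfolding expsum_def char_sum_def sum.reindex[OF inj] o_def
  proof (rule sum.cong[OF refl])
    fix x assume "x \<in> S"
    then have x: "int (nat x) = x" using subsets(1) by auto
    have "zeta N ^ (nat x * u) = zeta N powi (int (nat x * u))" by (rule power_int_of_nat[symmetric])
    also have "\<dots> = zeta N powi (x * int u)" using x by (metis of_nat_mult)
    also have "\<dots> = zeta N powi (x * (int u mod int N))"
      by (rule zeta_powi_cong[OF N]) (simp add: mod_mult_right_eq)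
    finally show "zeta N ^ (nat x * u) = zeta N powi (x * (int u mod int N))" .
  qed
qed

lemma nat_image_subset: "nat ` S \<subseteq> {..<N}"
  using subsetD[OF subsets(1)] by (force simp: nat_less_iff)

lemma unit_value_const:
  obtains n where "\<And>u. coprime u N \<Longrightarrow> cmod (expsum N (nat ` S) u) ^ 2 = real n"
    "\<And>u. coprime u N \<Longrightarrow> n * card T = card S ^ 2 * nu N T (int u mod int N)"
proof -
  have eq: "cmod (expsum N (nat ` S) u) ^ 2 * real (card T) = real (card S) ^ 2 * real (nu N T (int u mod int N))" for u
    unfolding expsum_eq_char_sum using N by (intro norm_char_sum_eq) simp
  have "cmod (expsum N (nat ` S) u) ^ 2 \<in> \<rat>" for u
  proof -
    have "cmod (expsum N (nat ` S) u) ^ 2 = real (card S) ^ 2 * real (nu N T (int u mod int N)) / real (card T)"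
      using eq[of u] card_pos by (simp add: field_simps)
    also have "\<dots> \<in> \<rat>" by (intro Rats_divide Rats_mult Rats_power) auto
    finally show ?thesis .
  qed
  then obtain n where n: "\<And>u. coprime u N \<Longrightarrow> cmod (expsum N (nat ` S) u) ^ 2 = real n"
    using expsum_norm_const[OF N nat_image_subset] by blast
  have "n * card T = card S ^ 2 * nu N T (int u mod int N)" if "coprime u N" for u
  proof -
    have "real (n * card T) = real (card S ^ 2 * nu N T (int u mod int N))"
      using eq[of u] n[OF that] by simp
    then show ?thesis by (simp only: of_nat_eq_iff)
  qed
  then show ?thesis using n that by blast
qed

end

section \<open>Primitive subsets and unit differences\<close>

lemma subgroup_multiples:
  assumes "N > 0" "p dvd N"
  shows "subgroup {x \<in> {0..<int N}. int p dvd x} (integer_mod_group N)"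
proof
  show "inv\<^bsub>integer_mod_group N\<^esub> x \<in> {x \<in> {0..<int N}. int p dvd x}"
    if "x \<in> {x \<in> {0..<int N}. int p dvd x}" for x
  proof -
    have "int p dvd - x mod int N" using that assms by (simp add: dvd_mod_iff)
    then show ?thesis
      using that assms by (simp add: inv_integer_mod_group carrier_integer_mod_group)
  qed
qed (use assms in \<open>auto simp: carrier_integer_mod_group mult_integer_mod_group one_integer_mod_group dvd_mod_iff\<close>)

lemma primitive_subset_not_cong:
  assumes N: "N > 0" "p dvd N" "p > 1" and T: "primitive_subset N T" "a \<in> T"
  shows "\<exists>t\<in>T. \<not> int p dvd t - a"
proof (rule ccontr)
  assume "\<not> ?thesis"
  then have dvd: "int p dvd t - a" if "t \<in> T" for t using that by blast
  define H where "H = {x \<in> {0..<int N}. int p dvd x}"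
  have sub: "T \<subseteq> {0..<int N}" using T N by (simp add: primitive_subset_def carrier_integer_mod_group)
  have "H \<noteq> carrier (integer_mod_group N)"
  proof -
    have "p \<le> N" using N by (simp add: dvd_imp_le)
    then have "1 \<in> {0..<int N}" using N by auto
    moreover have "1 \<notin> H" using N by (simp add: H_def)
    ultimately show ?thesis using N by (auto simp: carrier_integer_mod_group)
  qed
  moreover have "T \<subseteq> H #>\<^bsub>integer_mod_group N\<^esub> a"
  proof
    fix t assume t: "t \<in> T"
    have "int p dvd (t - a) mod int N" using dvd[OF t] N(2) by (simp add: dvd_mod_iff)
    then have "(t - a) mod int N \<in> H" using N by (simp add: H_def)
    moreover have "t = ((t - a) mod int N + a) mod int N"
      using sub t by (auto simp: mod_add_left_eq)
    ultimately show "t \<in> H #>\<^bsub>integer_mod_group N\<^esub> a"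
      unfolding r_coset_def using N by (auto simp: mult_integer_mod_group)
  qed
  moreover have "subgroup H (integer_mod_group N)" unfolding H_def by (rule subgroup_multiples[OF N(1,2)])
  moreover have "a \<in> carrier (integer_mod_group N)" using T by (auto simp: primitive_subset_def)
  ultimately show False using T(1) unfolding primitive_subset_def by blast
qed

text \<open>A set of pairs any two of which agree in some coordinate lies on a line.\<close>

lemma primitive_subset_unit_difference:
  assumes N: "N > 0" "p dvd N" "q dvd N" "p > 1" "q > 1" and T: "primitive_subset N T" "T \<noteq> {}"
  shows "\<exists>t\<in>T. \<exists>t'\<in>T. \<not> int p dvd t - t' \<and> \<not> int q dvd t - t'"
proof -
  obtain a where a: "a \<in> T" using T by blast
  obtain b where b: "b \<in> T" "\<not> int p dvd b - a" using primitive_subset_not_cong[OF N(1,2,4) T(1) a] by blast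
  obtain c where c: "c \<in> T" "\<not> int q dvd c - a" using primitive_subset_not_cong[OF N(1,3,5) T(1) a] by blast
  show ?thesis
  proof (cases "int q dvd b - a \<and> int p dvd c - a")
    case True
    have "\<not> int p dvd b - c"
    proof
      assume "int p dvd b - c"
      from dvd_add[OF this conjunct2[OF True]] show False using b(2) by simp
    qed
    moreover have "\<not> int q dvd b - c"
    proof
      assume "int q dvd b - c"
      from dvd_diff[OF conjunct1[OF True] this] show False using c(2) by simp
    qed
    ultimately show ?thesis using b c by blast
  next
    case False
    then show ?thesis using a b c by blast
  qed
qed

section \<open>The bound for the order\<close>

text \<open>\<open>m\<close> is the common value of \<open>nu N T\<close> at the units, positive
  since \<open>t - t'\<close> is one. The \<open>M\<close> residues \<open>1 + P * j\<close> are
  units, as every prime of \<open>N\<close> divides \<open>P\<close>, and together contribute at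
  most the total \<open>card T ^ 2\<close>.\<close>

lemma (in formal_dual_pair) unit_value_bounds:
  assumes P: "N = P * M" "P > 1" "\<And>l. prime l \<Longrightarrow> l dvd N \<Longrightarrow> l dvd P"
    and t: "t \<in> T" "t' \<in> T" "coprime (t - t') (int N)"
  obtains n m where "\<And>u. coprime u N \<Longrightarrow> cmod (expsum N (nat ` S) u) ^ 2 = real n"
    "n * card T = card S ^ 2 * m" "m > 0" "M * m \<le> card T ^ 2"
proof -
  obtain n where n: "\<And>u. coprime u N \<Longrightarrow> cmod (expsum N (nat ` S) u) ^ 2 = real n"
    "\<And>u. coprime u N \<Longrightarrow> n * card T = card S ^ 2 * nu N T (int u mod int N)"
    using unit_value_const by blast
  define m where "m = nu N T (1 mod int N)"
  have m: "n * card T = card S ^ 2 * m" using n(2)[of 1] by (simp add: m_def)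
  have nu_m: "nu N T (int u mod int N) = m" if "coprime u N" for u
    using n(2)[OF that] m card_pos by simp
  define y where "y = (t - t') mod int N"
  have y: "y \<ge> 0" "y < int N" using N by (auto simp: y_def)
  have "coprime y (int N)" unfolding y_def using t(3) N by (simp add: coprime_commute)
  then have "coprime (nat y) N" using y by (metis coprime_int_iff int_nat_eq)
  then have "nu N T y = m" using nu_m[of "nat y"] y by simp
  moreover have "nu N T y > 0"
  proof -
    have "(t, t') \<in> {(t, t'). t \<in> T \<and> t' \<in> T \<and> (t - t') mod int N = y}"
      using t by (simp add: y_def)
    moreover have "finite {(t, t'). t \<in> T \<and> t' \<in> T \<and> (t - t') mod int N = y}"
      by (rule finite_subset[of _ "T \<times> T"]) (use finite_sets in auto)
    ultimately show ?thesis unfolding nu_def using card_gt_0_iff by blast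
  qed
  ultimately have "m > 0" by simp
  have unit: "coprime (1 + P * j) N" for j
  proof (rule coprimeI_by_prime)
    fix l assume l: "prime l" "l dvd N"
    then have "l dvd P * j" using P(3) by simp
    then show "\<not> l dvd 1 + P * j" using l(1) by (metis dvd_add_left_iff not_prime_unit)
  qed
  have less: "1 + P * j < N" if "j < M" for j
  proof -
    have "1 + P * j < P + P * j" using P(2) by simp
    also have "\<dots> = P * Suc j" by simp
    also have "\<dots> \<le> P * M" using that by (intro mult_le_mono2) simp
    finally show ?thesis using P(1) by simp
  qed
  let ?g = "\<lambda>j. int (1 + P * j)"
  have "M * m = (\<Sum>j<M. nu N T (?g j))"
  proof -
    have "nu N T (?g j) = m" if "j < M" for j
      using nu_m[OF unit[of j]] less[OF that] by (metis mod_less of_nat_mod)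
    then show ?thesis by simp
  qed
  also have "\<dots> = (\<Sum>y\<in>?g ` {..<M}. nu N T y)"
    using P(2) by (subst sum.reindex) (auto simp: inj_on_def)
  also have "\<dots> \<le> (\<Sum>y\<in>{0..<int N}. nu N T y)"
  proof (rule sum_mono2)
    show "?g ` {..<M} \<subseteq> {0..<int N}"
    proof
      fix y assume "y \<in> ?g ` {..<M}"
      then obtain j where "j < M" "y = ?g j" by blast
      then show "y \<in> {0..<int N}" using less[of j] by (simp del: of_nat_add of_nat_mult)
    qed
  qed auto
  also have "\<dots> = card T ^ 2"
    using sum_nu[OF N finite_sets(2), of "\<lambda>_. 1 :: nat"] by (simp add: power2_eq_square)
  finally have "M * m \<le> card T ^ 2" .
  with n(1) m \<open>m > 0\<close> show ?thesis by (rule that)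
qed

lemma dvd_power_of_prime_dvd:
  fixes K W :: nat
  assumes "K > 0" "\<And>l. prime l \<Longrightarrow> l dvd K \<Longrightarrow> l dvd W"
  shows "\<exists>i. K dvd W ^ i"
  using assms
proof (induction K rule: prime_divisors_induct)
  case (unit K)
  then show ?case by auto
next
  case (factor l K)
  then obtain i where "K dvd W ^ i" by auto
  then have "l * K dvd W * W ^ i" using factor by (intro mult_dvd_mono) auto
  then show ?case by (metis power_Suc)
qed simp

text \<open>The descent bound \<open>n \<le> F ^ 2\<close> is played against
  \<open>M \<le> n ^ 2 * P ^ 2\<close>, where \<open>N = P * M\<close>.\<close>

lemma formal_dual_bound:
  assumes dual: "formal_dual_pair N S T"
    and prim: "primitive_subset N S" "primitive_subset N T"
    and pq: "prime p" "prime q" "p dvd N" "q dvd N" "p * q dvd N"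
    and N_primes: "\<And>l. prime l \<Longrightarrow> l dvd N \<Longrightarrow> l = p \<or> l = q"
    and F: "F > 0" "4 dvd F" "p dvd F" "q dvd F"
    and dec: "\<And>r K. prime r \<Longrightarrow> r \<le> (p * q) ^ 2 \<Longrightarrow> K > 0 \<Longrightarrow> coprime r K \<Longrightarrow>
      (\<And>l. prime l \<Longrightarrow> l dvd K \<Longrightarrow> l = p \<or> l = q) \<Longrightarrow> \<exists>j\<ge>1. [1 + F = r ^ j] (mod K)"
  shows "N \<le> F ^ 4 * (p * q) ^ 3"
proof -
  interpret formal_dual_pair N S T by (rule dual)
  interpret sym: formal_dual_pair N T S by unfold_locales (fact N, fact dual_sym)
  define P where "P = p * q"
  have pq1: "p > 1" "q > 1" using pq prime_gt_1_nat by auto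
  then have P1: "P > 1" unfolding P_def by (rule less_1_mult)
  obtain M where M: "N = P * M" using pq(5) unfolding P_def by blast
  have NP: "l dvd P" if "prime l" "l dvd N" for l
    using N_primes[OF that] by (auto simp: P_def)
  have unit: "coprime y (int N)" if "\<not> int p dvd y" "\<not> int q dvd y" for y
  proof -
    have "coprime (nat \<bar>y\<bar>) N"
    proof (rule coprimeI_by_prime)
      fix l assume l: "prime l" "l dvd N"
      then show "\<not> l dvd nat \<bar>y\<bar>" using N_primes[OF l] that by (auto simp: nat_abs_dvd_iff int_dvd_int_iff[symmetric] simp del: int_dvd_int_iff)
    qed
    then show ?thesis by (simp add: coprime_int_iff[symmetric] del: coprime_int_iff)
  qed
  obtain t t' where t: "t \<in> T" "t' \<in> T" "coprime (t - t') (int N)"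
    using primitive_subset_unit_difference[OF N pq(3,4) pq1 prim(2) subsets(4)] unit by blast
  obtain s s' where s: "s \<in> S" "s' \<in> S" "coprime (s - s') (int N)"
    using primitive_subset_unit_difference[OF N pq(3,4) pq1 prim(1) subsets(3)] unit by blast
  obtain n m where n: "\<And>u. coprime u N \<Longrightarrow> cmod (expsum N (nat ` S) u) ^ 2 = real n"
    "n * card T = card S ^ 2 * m" "m > 0" "M * m \<le> card T ^ 2"
    using unit_value_bounds[OF M P1 NP t] by metis
  obtain m' where m': "m' > 0" "M * m' \<le> card S ^ 2"
    using sym.unit_value_bounds[OF M P1 NP s] by metis
  have Mpos: "M > 0" using N M by auto
  have "M * 1 \<le> M * m'" using m'(1) by (intro mult_le_mono2) simp
  from le_trans[OF this m'(2)] have MS: "M \<le> card S ^ 2" by simp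
  have ST: "card S * card T = P * M" using card_mult M by simp
  have mP: "m \<le> P ^ 2"
  proof -
    have "(M * m) * M \<le> card T ^ 2 * card S ^ 2" using n(4) MS by (rule mult_le_mono)
    also have "\<dots> = (card S * card T) ^ 2" by (simp add: power_mult_distrib)
    also have "\<dots> = M ^ 2 * P ^ 2" unfolding ST by (simp add: power_mult_distrib)
    finally have "M ^ 2 * m \<le> M ^ 2 * P ^ 2" by (simp add: power2_eq_square mult_ac)
    then show ?thesis using Mpos by simp
  qed
  \<comment> \<open>Combines \<open>M \<le> card S ^ 2 \<le> n * card T\<close>; the cube is taken
    so that \<open>card S * card T = P * M\<close> appears and \<open>M ^ 2\<close> cancels.\<close>
  have nM: "M \<le> n ^ 2 * P ^ 2"
  proof -
    have "M ^ 3 \<le> (card S ^ 2) ^ 3" using MS by (rule power_mono) simp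
    also have "\<dots> = (card S ^ 2) ^ 2 * card S ^ 2" by (simp add: power_mult[symmetric] power_add[symmetric])
    also have "\<dots> \<le> (n * card T) ^ 2 * card S ^ 2"
      using n(2,3) by (intro mult_le_mono1 power_mono) auto
    also have "\<dots> = n ^ 2 * (card S * card T) ^ 2" by (simp add: power_mult_distrib)
    also have "\<dots> = M ^ 2 * (n ^ 2 * P ^ 2)" unfolding ST by (simp add: power_mult_distrib)
    finally have "M ^ 2 * M \<le> M ^ 2 * (n ^ 2 * P ^ 2)" by (simp add: power2_eq_square power3_eq_cube mult_ac)
    then show ?thesis using Mpos by simp
  qed
  have npos: "n > 0" using n(2,3) card_pos by (metis mult_eq_0_iff neq0_conv power_not_zero)
  have "n \<le> F ^ 2"
  proof (rule expsum_norm_le[OF N nat_image_subset npos n(1) F(1,2)])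
    show "l dvd F" if "prime l" "l dvd N" for l using N_primes[OF that] F by auto
    show "\<exists>a K j. N = r ^ a * K \<and> coprime r K \<and> j \<ge> 1 \<and> [1 + F = r ^ j] (mod K)"
      if r: "prime r" "r dvd n" for r
    proof -
      \<comment> \<open>A prime of \<open>n\<close> divides \<open>card S\<close>, hence
        \<open>N\<close>, or divides \<open>m \<le> P ^ 2\<close>. So the relevant primes are
        bounded independently of \<open>N\<close>.\<close>
      have "r dvd card S ^ 2 * m" using r(2) n(2) by (metis dvd_mult2)
      then have "r dvd card S \<or> r dvd m" using r(1) by (auto simp: prime_dvd_mult_iff dest: prime_dvd_power)
      then have "r \<le> P ^ 2"
      proof
        assume "r dvd card S"
        then have "r dvd N" using card_mult by (metis dvd_mult2)
        then have "r dvd P" using NP r(1) by blast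
        then have "r \<le> P" using P1 by (intro dvd_imp_le) auto
        also have "P \<le> P ^ 2" by (simp add: power2_eq_square)
        finally show ?thesis .
      next
        assume "r dvd m"
        from le_trans[OF dvd_imp_le[OF this n(3)] mP] show ?thesis .
      qed
      obtain a K where aK: "\<not> r dvd K" "N = K * r ^ a"
        using prime_power_canonical[OF r(1) N] by blast
      have "K > 0" using aK N by (cases "K = 0") auto
      moreover have "coprime r K" using aK(1) r(1) by (simp add: prime_imp_coprime)
      moreover have "l = p \<or> l = q" if "prime l" "l dvd K" for l
        using N_primes[OF that(1)] that(2) aK(2) by simp
      ultimately obtain j where "j \<ge> 1" "[1 + F = r ^ j] (mod K)"
        using dec[OF r(1)] \<open>r \<le> P ^ 2\<close> unfolding P_def by blast
      then show ?thesis using aK(2) \<open>coprime r K\<close> by (metis mult.commute)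
    qed
  qed
  then have "n ^ 2 \<le> (F ^ 2) ^ 2" by (rule power_mono) simp
  then have "M \<le> F ^ 4 * P ^ 2" using nM by (simp add: power_mult[symmetric]) (meson le_trans mult_le_mono1)
  then have "N \<le> P * (F ^ 4 * P ^ 2)" unfolding M by (rule mult_le_mono2)
  then show ?thesis by (simp add: P_def power2_eq_square power3_eq_cube mult_ac)
qed

text \<open>Only finitely many primes \<open>r \<le> B\<close> occur, so the product of their moduli
  works for all of them at once.\<close>

lemma exists_decomposition_modulus:
  fixes p q :: nat
  assumes "prime p" "prime q"
  shows "\<exists>F>0. 4 dvd F \<and> p dvd F \<and> q dvd F \<and>
    (\<forall>r K. prime r \<longrightarrow> r \<le> B \<longrightarrow> K > 0 \<longrightarrow> coprime r K \<longrightarrow>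
      (\<forall>l. prime l \<longrightarrow> l dvd K \<longrightarrow> l = p \<or> l = q) \<longrightarrow> (\<exists>j\<ge>1. [1 + F = r ^ j] (mod K)))"
proof -
  \<comment> \<open>Omitting \<open>r\<close> keeps \<open>W r\<close> prime to \<open>r\<close>
    when \<open>r\<close> is \<open>p\<close> or \<open>q\<close>; the primes of a \<open>K\<close>
    coprime to \<open>r\<close> still divide \<open>W r\<close>.\<close>
  define W where "W r = \<Prod>({p, q} - {r})" for r
  have W: "W r > 0" for r unfolding W_def using assms prime_gt_0_nat by (intro prod_pos) auto
  have W_coprime: "coprime r (W r)" if "prime r" for r
    unfolding W_def using that assms by (intro prod_coprime_right) (auto simp: primes_coprime)
  have "\<forall>r\<in>{r. prime r}. \<exists>y>0. \<forall>t K i. [t = 1] (mod y) \<longrightarrow> t > 0 \<longrightarrow> K > 0 \<longrightarrow> K dvd W r ^ i \<longrightarrow>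
      (\<exists>j\<ge>1. [t = r ^ j] (mod K))"
    using exists_power_cong[OF _ W W_coprime] prime_gt_1_nat by blast
  from bchoice[OF this] obtain y where y': "\<forall>r\<in>{r. prime r}. y r > 0 \<and> (\<forall>t K i. [t = 1] (mod y r) \<longrightarrow>
      t > 0 \<longrightarrow> K > 0 \<longrightarrow> K dvd W r ^ i \<longrightarrow> (\<exists>j\<ge>1. [t = r ^ j] (mod K)))" by blast
  have y: "y r > 0"
    "[t = 1] (mod y r) \<Longrightarrow> t > 0 \<Longrightarrow> K > 0 \<Longrightarrow> K dvd W r ^ i \<Longrightarrow> \<exists>j\<ge>1. [t = r ^ j] (mod K)"
    if "prime r" for r t K i
    using bspec[OF y', of r] that by blast+
  define F where "F = 4 * p * q * (\<Prod>r | prime r \<and> r \<le> B. y r)"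
  have fin: "finite {r. prime r \<and> r \<le> B}" by (rule finite_subset[of _ "{..B}"]) auto
  have "(\<Prod>r | prime r \<and> r \<le> B. y r) > 0" using y(1) by (intro prod_pos) auto
  then have "F > 0" using assms prime_gt_0_nat by (simp add: F_def)
  moreover have "4 dvd F" "p dvd F" "q dvd F" by (simp_all add: F_def mult_ac)
  moreover have "\<exists>j\<ge>1. [1 + F = r ^ j] (mod K)"
    if r: "prime r" "r \<le> B" and K: "K > 0" "coprime r K" "\<And>l. prime l \<Longrightarrow> l dvd K \<Longrightarrow> l = p \<or> l = q" for r K
  proof -
    have "y r dvd (\<Prod>r | prime r \<and> r \<le> B. y r)" using r fin by (intro dvd_prodI) auto
    then have "y r dvd F" by (simp add: F_def)
    then have 1: "[1 + F = 1] (mod y r)" by (simp only: cong_add_lcancel_0_nat cong_0_iff)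
    have "l dvd W r" if l: "prime l" "l dvd K" for l
    proof -
      have "l \<noteq> r" using l K(2) by (metis coprime_common_divisor dvd_refl not_prime_unit)
      then have "l \<in> {p, q} - {r}" using K(3)[OF l] by auto
      then show ?thesis unfolding W_def by (intro dvd_prodI[of _ _ "\<lambda>x. x", simplified]) auto
    qed
    then obtain i where "K dvd W r ^ i" using dvd_power_of_prime_dvd[OF K(1)] by blast
    then show ?thesis using y(2)[OF r(1) 1] K(1) by simp
  qed
  ultimately show ?thesis by blast
qed

theorem theorem7p4:
  fixes p q :: nat
  assumes "prime p" and "prime q" and "p \<noteq> q"
  shows "finite {N :: nat. N > 0 \<and> rad N = p * q \<and>
           (\<exists>S T. primitive_subset N S \<and> primitive_subset N T \<and> formally_dual N S T)}"
proof -
  \<comment> \<open>\<open>F\<close> is fixed from \<open>p\<close> and \<open>q\<close> alone,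
    before \<open>N\<close>, so the resulting bound is uniform.\<close>
  obtain F where F: "F > 0" "4 dvd F" "p dvd F" "q dvd F"
    "\<And>r K. prime r \<Longrightarrow> r \<le> (p * q) ^ 2 \<Longrightarrow> K > 0 \<Longrightarrow> coprime r K \<Longrightarrow>
      (\<And>l. prime l \<Longrightarrow> l dvd K \<Longrightarrow> l = p \<or> l = q) \<Longrightarrow> \<exists>j\<ge>1. [1 + F = r ^ j] (mod K)"
    using exists_decomposition_modulus[OF assms(1,2), of "(p * q) ^ 2"] by metis
  have "N \<le> F ^ 4 * (p * q) ^ 3"
    if N: "N > 0" "rad N = p * q" and ST: "primitive_subset N S" "primitive_subset N T" "formally_dual N S T"
    for N S T
  proof -
    have prime_dvd: "l dvd N \<longleftrightarrow> l = p \<or> l = q" if "prime l" for l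
    proof -
      have "l dvd N \<longleftrightarrow> l \<in> prime_factors N" using that N(1) by (simp add: prime_factors_dvd)
      also have "\<dots> \<longleftrightarrow> l dvd p * q"
      proof
        assume "l \<in> prime_factors N"
        then have "l dvd \<Prod>(prime_factors N)" by (intro dvd_prodI[of _ _ "\<lambda>x. x", simplified]) auto
        then show "l dvd p * q" using N(2) by (simp add: rad_def)
      next
        assume "l dvd p * q"
        then have "l dvd \<Prod>(prime_factors N)" using N(2) by (simp add: rad_def)
        then obtain l' where "l' \<in> prime_factors N" "l dvd l'"
          using \<open>prime l\<close> prime_dvd_prod_iff[of "prime_factors N" l "\<lambda>x. x"] by auto
        then show "l \<in> prime_factors N" using that primes_dvd_imp_eq by (metis in_prime_factors_imp_prime)
      qed
      also have "\<dots> \<longleftrightarrow> l = p \<or> l = q"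
        using that assms(1,2) by (auto simp: prime_dvd_mult_iff primes_dvd_imp_eq)
      finally show ?thesis .
    qed
    have "p dvd N" "q dvd N" using prime_dvd assms by auto
    moreover have "coprime p q" using assms by (simp add: primes_coprime)
    ultimately have "p * q dvd N" by (intro divides_mult)
    then show ?thesis
      using formal_dual_bound[of N S T p q F] F ST N(1) prime_dvd assms \<open>p dvd N\<close> \<open>q dvd N\<close>
      by (simp add: formal_dual_pair_def)
  qed
  then have "{N :: nat. N > 0 \<and> rad N = p * q \<and>
      (\<exists>S T. primitive_subset N S \<and> primitive_subset N T \<and> formally_dual N S T)} \<subseteq> {..F ^ 4 * (p * q) ^ 3}"
    by auto
  then show ?thesis by (rule finite_subset) simp
qed

end
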